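(* Let $\mathfrak a\ge1$ and $\mathfrak b\ge0$ be integers. If $w$ is a primitive solution with parameters $(\mathfrak a,\mathfrak b)$, then at least one of the following holds: (I) $w$ is a reversed standard word; (II) there exist a reversed standard word $S$ with parameters $(\mathfrak a,\mathfrak b)$ such that $|S|>|S_6|$ and a nontrivial and primitive pattern word $u$ such that $w=\mathcal P_S(u)$. Conversely, if (I) holds for a word $w$, then $w$ is a primitive solution (for suitable parameters and up to exchanging the letters $0$ and $1$), and if (II) holds for a word $w$, then $w$ is a primitive solution with parameters $(\mathfrak a,\mathfrak b)$. Moreover, if $w$ is a nonprimitive solution with parameters $(\mathfrak a,\mathfrak b)$, then $w$ is a power of a primitive solution with parameters $(\mathfrak a,\mathfrak b)$.
   Context: Words are over $\{0,1\}$ unless stated otherwise. A word $w$ is primitive if $w=v^n$ only for $n=1$. Minimal square roots: for integers $\mathfrak a\ge1$, $\mathfrak b\ge0$ let $S_1=0$, $S_2=010^{\mathfrak a-1}$, $S_3=010^{\mathfrak a}$, $S_4=10^{\mathfrak a}$, $S_5=10^{\mathfrak a+1}(10^{\mathfrak a})^{\mathfrak b}$, $S_6=10^{\mathfrak a+1}(10^{\mathfrak a})^{\mathfrak b+1}$. Let $\mathcal L(\mathfrak a,\mathfrak b)$ be the set of all finite factors of infinite concatenations of the words $S_5$ and $S_6$. Let $\Pi(\mathfrak a,\mathfrak b)$ be the set of nonempty words in $\mathcal L(\mathfrak a,\mathfrak b)$ that are products $X_1^2\cdots X_n^2$ with all $X_i\in\{S_1,\dots,S_6\}$. A nonempty word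 $w$ is a solution with parameters $(\mathfrak a,\mathfrak b)$ if $w^2\in\Pi(\mathfrak a,\mathfrak b)$ and $w$ can be written as $w=X_1\cdots X_n$ with $X_i\in\{S_1,\dots,S_6\}$ such that $X_1^2\cdots X_n^2=(X_1\cdots X_n)^2$. The solution is primitive if $w$ is a primitive word. That $w$ is a solution "for suitable parameters and up to exchanging the letters" means that for some $\mathfrak a'\ge1$, $\mathfrak b'\ge0$ either $w$ or the word obtained from $w$ by exchanging $0$ and $1$ is a solution with parameters $(\mathfrak a',\mathfrak b')$. Standard words: for a sequence $(d_k)_{k\ge1}$ of positive integers put $s_{-1}=1$, $s_0=0$, $s_1=s_0^{d_1-1}s_{-1}$, and $s_k=s_{k-1}^{d_k}s_{k-2}$ for $k\ge2$. All words $s_k$ ($k\ge-1$) so obtained are standard words; a reversed standard word is a standard word read from right to left. A reversed standard word has parameters $(\mathfrak a,\mathfrak b)$ if it is the reversal of some $s_k$, $k\ge0$, for a sequence with $d_1=\mathfrak a+1$ and $d_2=\mathfrak b+1$. Pattern words: a nonempty word $u=a_0\cdots a_{n-1}$ over the two-letter alphabet $\{S,L\}$ is a pattern word if $a_i=a_j$ whenever $i,j\in\{0,\dots,n-1\}$ are in the same orbit of the map $x\mapsto 2x\bmod n$, i.e. whenever there are $k_1,k_2\ge0$ with $2^{k_1}i\equiv2^{k_2}j\pmod n$. It is nontrivial if $|u|>1$. For a word $v$ with $|v|\ge2$, $L(v)$ is the word obtained from $v$ by exchanging its first two letters, and $\mathcal P_v(u)$ is the word obtained from $u$ by replacing each letter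 $S$ by $v$ and each letter $L$ by $L(v)$. *)

theory Defs
  imports
    "HOL-Library.Stream"
    "HOL-Library.Z2"
    "HOL-Number_Theory.Cong"
begin

type_synonym word = "bit list"

definition word_power :: "'a list \<Rightarrow> nat \<Rightarrow> 'a list" where
  "word_power v n = concat (replicate n v)"

text \<open>Since the empty word is also its own zeroth power, it is not primitive.\<close>

definition primitive :: "'a list \<Rightarrow> bool" where
  "primitive w \<longleftrightarrow> (\<forall>v n. w = word_power v n \<longrightarrow> n = 1)"

definition exchange_letters :: "word \<Rightarrow> word" where
  "exchange_letters = map (\<lambda>x. x + 1)"

text \<open>
  The six minimal square roots. The first parameter is always assumed to be at least \<open>1\<close>,
  so the subtraction in \<open>S2\<close> does not truncate.
\<close>

definition S1 :: word where
  "S1 = [0]"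

definition S2 :: "nat \<Rightarrow> word" where
  "S2 a = [0, 1] @ replicate (a - 1) 0"

definition S3 :: "nat \<Rightarrow> word" where
  "S3 a = [0, 1] @ replicate a 0"

definition S4 :: "nat \<Rightarrow> word" where
  "S4 a = [1] @ replicate a 0"

definition S5 :: "nat \<Rightarrow> nat \<Rightarrow> word" where
  "S5 a b = [1] @ replicate (a + 1) 0 @ word_power ([1] @ replicate a 0) b"

definition S6 :: "nat \<Rightarrow> nat \<Rightarrow> word" where
  "S6 a b = [1] @ replicate (a + 1) 0 @ word_power ([1] @ replicate a 0) (b + 1)"

definition min_square_roots :: "nat \<Rightarrow> nat \<Rightarrow> word set" where
  "min_square_roots a b = {S1, S2 a, S3 a, S4 a, S5 a b, S6 a b}"

text \<open>Finite factors of infinite concatenations of \<open>S5 a b\<close> and \<open>S6 a b\<close>.\<close>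

definition lang :: "nat \<Rightarrow> nat \<Rightarrow> word set" where
  "lang a b = {stake n (sdrop m (flat Xs)) | n m Xs. sset Xs \<subseteq> {S5 a b, S6 a b}}"

definition concat_squares :: "'a list list \<Rightarrow> 'a list" where
  "concat_squares Xs = concat (map (\<lambda>X. X @ X) Xs)"

definition square_products :: "nat \<Rightarrow> nat \<Rightarrow> word set" where
  "square_products a b =
     {w \<in> lang a b. w \<noteq> [] \<and> (\<exists>Xs. set Xs \<subseteq> min_square_roots a b \<and> w = concat_squares Xs)}"

definition solution :: "nat \<Rightarrow> nat \<Rightarrow> word \<Rightarrow> bool" where
  "solution a b w \<longleftrightarrow>
     w \<noteq> [] \<and> w @ w \<in> square_products a b \<and>
     (\<exists>Xs. set Xs \<subseteq> min_square_roots a b \<and> w = concat Xs \<and>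
           concat_squares Xs = concat Xs @ concat Xs)"

definition primitive_solution :: "nat \<Rightarrow> nat \<Rightarrow> word \<Rightarrow> bool" where
  "primitive_solution a b w \<longleftrightarrow> solution a b w \<and> primitive w"

text \<open>
  \<open>standard_seq d k\<close> is the word \<open>s\<^sub>k\<close> for \<open>k \<ge> 0\<close>; the word \<open>s\<close> with index \<open>-1\<close> is \<open>[1]\<close> and
  enters the recursion only at \<open>k = 1\<close>. The value \<open>d 0\<close> is irrelevant.
\<close>

fun standard_seq :: "(nat \<Rightarrow> nat) \<Rightarrow> nat \<Rightarrow> word" where
  "standard_seq d 0 = [0]"
| "standard_seq d (Suc 0) = word_power (standard_seq d 0) (d 1 - 1) @ [1]"
| "standard_seq d (Suc (Suc k)) =
     word_power (standard_seq d (Suc k)) (d (Suc (Suc k))) @ standard_seq d k"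

definition standard_word :: "word \<Rightarrow> bool" where
  "standard_word w \<longleftrightarrow> w = [1] \<or> (\<exists>d k. (\<forall>i\<ge>1. d i \<ge> 1) \<and> w = standard_seq d k)"

definition reversed_standard_word :: "word \<Rightarrow> bool" where
  "reversed_standard_word w \<longleftrightarrow> standard_word (rev w)"

definition reversed_standard_word_with :: "nat \<Rightarrow> nat \<Rightarrow> word \<Rightarrow> bool" where
  "reversed_standard_word_with a b w \<longleftrightarrow>
     (\<exists>d k. (\<forall>i\<ge>1. d i \<ge> 1) \<and> d 1 = a + 1 \<and> d 2 = b + 1 \<and> w = rev (standard_seq d k))"

datatype pattern_letter = Letter_S | Letter_L

definition pattern_word :: "pattern_letter list \<Rightarrow> bool" where
  "pattern_word u \<longleftrightarrow>
     u \<noteq> [] \<and>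
     (\<forall>i < length u. \<forall>j < length u.
        (\<exists>k1 k2. [2 ^ k1 * i = 2 ^ k2 * j] (mod length u)) \<longrightarrow> u ! i = u ! j)"

text \<open>Only used for words of length at least \<open>2\<close>; shorter words are left unchanged.\<close>

fun exchange_first_two :: "'a list \<Rightarrow> 'a list" where
  "exchange_first_two (x # y # zs) = y # x # zs"
| "exchange_first_two w = w"

definition substitute_pattern :: "'a list \<Rightarrow> pattern_letter list \<Rightarrow> 'a list" where
  "substitute_pattern v u =
     concat (map (\<lambda>c. case c of Letter_S \<Rightarrow> v | Letter_L \<Rightarrow> exchange_first_two v) u)"

definition pattern_type :: "nat \<Rightarrow> nat \<Rightarrow> word \<Rightarrow> bool" where
  "pattern_type a b w \<longleftrightarrow>
     (\<exists>S u. reversed_standard_word_with a b S \<and> length S > length (S6 a b) \<and>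
            pattern_word u \<and> length u > 1 \<and> primitive u \<and>
            w = substitute_pattern S u)"

end

theory Submission
  imports Defs
begin

text \<open>
  Extend \<open>w\<close> periodically to \<open>f\<close>, divide its letter counts by their gcd to get coprime
  \<open>\<alpha>\<close> (zeros) and \<open>\<beta>\<close> (ones), and let \<open>H\<close> be the prefix sum in which \<open>1\<close> counts \<open>\<alpha>\<close> and \<open>0\<close> counts
  \<open>-\<beta>\<close>. If \<open>w = X\<^sub>1 \<dots> X\<^sub>n\<close> solves the equation, then the factor \<open>X\<close> at position \<open>t\<close> also occurs twice
  in a row at \<open>2t\<close>, and \<open>H (2t) = 2 H t\<close>; hence \<open>H (p + t) = H p + H t\<close> for every position \<open>p\<close> of this
  factor. Taking for \<open>p\<close> a maximum or a minimum of \<open>H\<close> bounds \<open>H t\<close> and shows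
  \<open>-\<beta> \<le> H \<le> \<alpha>\<close>. Such a walk is deterministic except at its zeros, which are the
  multiples of \<open>m = \<alpha> + \<beta>\<close>. Therefore \<open>w\<close> is a product of blocks of length \<open>m\<close>, each of which is one of the
  two walks of slope \<open>(\<alpha>, \<beta>)\<close> from \<open>0\<close> to \<open>0\<close>; these are reversed standard words that differ by an
  exchange of the first two letters. No zero is interior to a factor, so every multiple of \<open>m\<close> is some \<open>t\<close> as
  above, and the blocks at \<open>jm\<close> and \<open>2jm\<close> agree: this is the pattern word condition.

  Conversely, for a walk whose slope fits the parameters, reading a square \<open>X\<^sup>2\<close> at height \<open>2h\<close> forces
  \<open>X\<close> at height \<open>h\<close>, which produces the decomposition one factor at a time.
\<close>

section \<open>Heights and walks\<close>

lemma bit_disj: "x = 0 \<or> x = (1::bit)"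
  by (cases x) auto

lemma word_power_simps [simp]:
  "word_power v 0 = []" "word_power v (Suc n) = v @ word_power v n"
  by (simp_all add: word_power_def)

lemma word_power_add: "word_power v (m + n) = word_power v m @ word_power v n"
  by (induction m) auto

lemma word_power_snoc: "word_power v n @ v = v @ word_power v n"
  by (induction n) auto

lemma length_word_power [simp]: "length (word_power v n) = n * length v"
  by (induction n) auto

lemma rev_word_power: "rev (word_power v n) = word_power (rev v) n"
  by (induction n) (auto simp: word_power_snoc)

lemma count_list_word_power [simp]: "count_list (word_power v n) x = n * count_list v x"
  by (induction n) auto

lemma count_list_replicate: "count_list (replicate n y) x = (if x = y then n else 0)"
  by (induction n) auto

lemma word_power_mult: "word_power (word_power v m) n = word_power v (m * n)"
  by (induction n) (auto simp: word_power_add)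

lemma length_bit_word: "length (w::word) = count_list w 0 + count_list w 1"
  by (induction w) (auto simp: bit_not_one_iff)

section \<open>Heights of words and occurrences in infinite words\<close>

definition height :: "int \<Rightarrow> int \<Rightarrow> word \<Rightarrow> int" where
  "height \<alpha> \<beta> w = \<alpha> * int (count_list w 1) - \<beta> * int (count_list w 0)"

lemma height_simps [simp]:
  "height \<alpha> \<beta> [] = 0"
  "height \<alpha> \<beta> (x # xs) = (if x = 1 then \<alpha> else - \<beta>) + height \<alpha> \<beta> xs"
  "height \<alpha> \<beta> (xs @ ys) = height \<alpha> \<beta> xs + height \<alpha> \<beta> ys"
  "height \<alpha> \<beta> (replicate n 0) = - (\<beta> * int n)"
  "height \<alpha> \<beta> (word_power xs n) = int n * height \<alpha> \<beta> xs"
  by (auto simp: height_def algebra_simps count_list_replicate bit_not_one_iff)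

text \<open>Infinite words are functions on positions, because the square of a factor at
  \<open>t\<close> is read at \<open>2 * t\<close>, possibly past the end of the finite
  word.\<close>

fun occurs_at :: "(nat \<Rightarrow> 'a) \<Rightarrow> nat \<Rightarrow> 'a list \<Rightarrow> bool" where
  "occurs_at f p [] \<longleftrightarrow> True"
| "occurs_at f p (x # xs) \<longleftrightarrow> f p = x \<and> occurs_at f (Suc p) xs"

lemma occurs_at_append [simp]:
  "occurs_at f p (xs @ ys) \<longleftrightarrow> occurs_at f p xs \<and> occurs_at f (p + length xs) ys"
  by (induction xs arbitrary: p) auto

lemma occurs_at_iff: "occurs_at f p xs \<longleftrightarrow> (\<forall>i<length xs. f (p + i) = xs ! i)"
proof (induction xs arbitrary: p)
  case (Cons x xs)
  show ?case unfolding occurs_at.simps Cons list.size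
    by (auto simp: nth_Cons less_Suc_eq_0_disj split: nat.splits)
qed auto

lemma occurs_at_take: "occurs_at f p xs \<Longrightarrow> occurs_at f p (take i xs)"
  by (auto simp: occurs_at_iff)

lemma occurs_at_unique:
  "occurs_at f p xs \<Longrightarrow> occurs_at f p ys \<Longrightarrow> length xs = length ys \<Longrightarrow> xs = ys"
  by (auto simp: occurs_at_iff intro: nth_equalityI)

primrec prefix_height :: "(nat \<Rightarrow> bit) \<Rightarrow> int \<Rightarrow> int \<Rightarrow> nat \<Rightarrow> int" where
  "prefix_height f \<alpha> \<beta> 0 = 0"
| "prefix_height f \<alpha> \<beta> (Suc p) = prefix_height f \<alpha> \<beta> p + (if f p = 1 then \<alpha> else - \<beta>)"

lemma prefix_height_occurs:
  "occurs_at f p xs \<Longrightarrow> prefix_height f \<alpha> \<beta> (p + length xs) = prefix_height f \<alpha> \<beta> p + height \<alpha> \<beta> xs"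
proof (induction xs arbitrary: p)
  case (Cons x xs)
  then show ?case using Cons.IH[of "Suc p"] by auto
qed auto

lemma prefix_height_take:
  assumes "occurs_at f p xs" "i \<le> length xs"
  shows "prefix_height f \<alpha> \<beta> (p + i) = prefix_height f \<alpha> \<beta> p + height \<alpha> \<beta> (take i xs)"
  using prefix_height_occurs[OF occurs_at_take[OF assms(1), of i], of \<alpha> \<beta>] assms(2) by (simp add: min_absorb2)

definition periodic :: "'a list \<Rightarrow> nat \<Rightarrow> 'a" where
  "periodic w p = w ! (p mod length w)"

lemma periodic_add [simp]: "periodic w (p + length w) = periodic w p"
  by (simp add: periodic_def)

lemma occurs_at_periodic: "occurs_at (periodic w) (n * length w) w"
  by (simp add: occurs_at_iff periodic_def)

lemma occurs_at_periodic0 [simp]: "occurs_at (periodic w) 0 w"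
  using occurs_at_periodic[of w 0] by simp

lemma prefix_height_periodic:
  assumes "height \<alpha> \<beta> w = 0"
  shows "prefix_height (periodic w) \<alpha> \<beta> (p + length w) = prefix_height (periodic w) \<alpha> \<beta> p"
proof (induction p)
  case 0
  then show ?case using prefix_height_occurs[OF occurs_at_periodic0, of w \<alpha> \<beta>] assms by simp
qed auto

lemma prefix_height_periodic_mult:
  assumes "height \<alpha> \<beta> w = 0"
  shows "prefix_height (periodic w) \<alpha> \<beta> (p + n * length w) = prefix_height (periodic w) \<alpha> \<beta> p"
proof (induction n)
  case (Suc n)
  then show ?case using prefix_height_periodic[OF assms, of "p + n * length w"] by (simp add: algebra_simps)
qed auto

lemma prefix_height_mod:
  assumes "height \<alpha> \<beta> w = 0"
  shows "prefix_height (periodic w) \<alpha> \<beta> (p mod length w) = prefix_height (periodic w) \<alpha> \<beta> p"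
  using prefix_height_periodic_mult[OF assms, of "p mod length w" "p div length w"] by simp

section \<open>Walks, finite and infinite\<close>

fun walk_word :: "int \<Rightarrow> int \<Rightarrow> int \<Rightarrow> word \<Rightarrow> bool" where
  "walk_word \<alpha> \<beta> h [] \<longleftrightarrow> True"
| "walk_word \<alpha> \<beta> h (x # xs) \<longleftrightarrow>
     (if x = 1 then h \<le> 0 \<and> walk_word \<alpha> \<beta> (h + \<alpha>) xs else h \<ge> 0 \<and> walk_word \<alpha> \<beta> (h - \<beta>) xs)"

lemma walk_word_append [simp]:
  "walk_word \<alpha> \<beta> h (xs @ ys) \<longleftrightarrow> walk_word \<alpha> \<beta> h xs \<and> walk_word \<alpha> \<beta> (h + height \<alpha> \<beta> xs) ys"
  by (induction xs arbitrary: h) (auto simp: algebra_simps)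

lemma walk_word_nth:
  assumes "walk_word \<alpha> \<beta> h w" "i < length w"
  shows "if w ! i = 1 then h + height \<alpha> \<beta> (take i w) \<le> 0 else h + height \<alpha> \<beta> (take i w) \<ge> 0"
proof -
  have "walk_word \<alpha> \<beta> h (take i w @ w ! i # drop (Suc i) w)"
    using assms by (simp add: id_take_nth_drop[symmetric])
  then show ?thesis by (auto split: if_splits)
qed

text \<open>From a nonzero height the walk steps in the direction of zero, possibly across it. At
  height 0 both letters are allowed; this is its only freedom.\<close>

locale walk =
  fixes f :: "nat \<Rightarrow> bit" and \<alpha> \<beta> :: int
  assumes pos: "\<alpha> > 0" "\<beta> > 0"
    and one: "f p = 1 \<Longrightarrow> prefix_height f \<alpha> \<beta> p \<le> 0"
    and zero: "f p = 0 \<Longrightarrow> prefix_height f \<alpha> \<beta> p \<ge> 0"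
begin

abbreviation H where "H \<equiv> prefix_height f \<alpha> \<beta>"

lemma range: "- \<beta> \<le> H p" "H p \<le> \<alpha>"
proof -
  have "- \<beta> \<le> H p \<and> H p \<le> \<alpha>"
  proof (induction p)
    case (Suc q)
    then show ?case using one[of q] zero[of q] bit_disj[of "f q"] pos by auto
  qed (use pos in simp)
  then show "- \<beta> \<le> H p" "H p \<le> \<alpha>" by auto
qed

lemma letter_neg: "H p < 0 \<Longrightarrow> f p = 1"
  using zero[of p] bit_disj[of "f p"] by auto

lemma letter_pos: "H p > 0 \<Longrightarrow> f p = 0"
  using one[of p] bit_disj[of "f p"] by auto

lemma H_0: "f p = 0 \<Longrightarrow> H (Suc p) = H p - \<beta>"
  and H_1: "f p = 1 \<Longrightarrow> H (Suc p) = H p + \<alpha>"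
  by auto

text \<open>\<open>H p - (n - 1) \<beta>\<close> is the height in front of the last of the
  \<open>n\<close> zeros. If it is positive, each of them is forced by
  \<open>letter_pos\<close>.\<close>

lemma occurs_zeros:
  "n = 0 \<or> H p - int (n - 1) * \<beta> > 0 \<Longrightarrow>
     occurs_at f p (replicate n 0) \<and> H (p + n) = H p - int n * \<beta>"
proof (induction n)
  case (Suc n)
  have "n = 0 \<or> H p - int (n - 1) * \<beta> > 0"
    using Suc.prems pos by (cases n) (auto simp: algebra_simps)
  with Suc.IH have IH: "occurs_at f p (replicate n 0)" "H (p + n) = H p - int n * \<beta>" by auto
  then have z: "f (p + n) = 0" using Suc.prems by (intro letter_pos) auto
  have "occurs_at f p (replicate n 0 @ [0])" using IH z by simp
  then have "occurs_at f p (replicate (Suc n) 0)" unfolding replicate_append_same replicate_Suc .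
  moreover have "H (p + Suc n) = H p - int (Suc n) * \<beta>"
    using H_0[OF z] IH(2) by (simp add: algebra_simps)
  ultimately show ?case by blast
qed auto

end

text \<open>Away from height 0 the sign of the height dictates the next letter, so two walks that
  start alike can part only at a zero.\<close>

lemma walk_deterministic:
  assumes "walk f \<alpha> \<beta>" "walk g \<alpha> \<beta>"
    and start: "prefix_height f \<alpha> \<beta> p = prefix_height g \<alpha> \<beta> q" "f p = g q"
    and nonzero: "\<And>i. 0 < i \<Longrightarrow> i < n \<Longrightarrow> prefix_height g \<alpha> \<beta> (q + i) \<noteq> 0"
    and "i < n"
  shows "prefix_height f \<alpha> \<beta> (p + i) = prefix_height g \<alpha> \<beta> (q + i) \<and> f (p + i) = g (q + i)"
  using \<open>i < n\<close>
proof (induction i)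
  case 0
  then show ?case using start by simp
next
  case (Suc i)
  interpret F: walk f \<alpha> \<beta> by fact
  interpret G: walk g \<alpha> \<beta> by fact
  have eq: "prefix_height f \<alpha> \<beta> (p + Suc i) = prefix_height g \<alpha> \<beta> (q + Suc i)"
    using Suc by auto
  have "prefix_height g \<alpha> \<beta> (q + Suc i) \<noteq> 0" using nonzero[of "Suc i"] Suc.prems by simp
  then show ?case
    using eq F.letter_neg F.letter_pos G.letter_neg G.letter_pos by (metis linorder_neqE_linordered_idom)
qed

locale coprime_walk = walk +
  assumes coprime: "coprime \<alpha> \<beta>"
begin

text \<open>The steps \<alpha> and -\<beta> agree modulo \<alpha> + \<beta>, so \<open>H p\<close>
  is congruent to \<open>-\<beta> p\<close>, and \<beta> is invertible there. Conversely, the range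
  of a walk contains no nonzero multiple of \<alpha> + \<beta>.\<close>

lemma height_zero_iff: "H p = 0 \<longleftrightarrow> (\<alpha> + \<beta>) dvd int p"
proof -
  have "(\<alpha> + \<beta>) dvd H p + \<beta> * int p"
  proof (induction p)
    case (Suc p)
    have "H (Suc p) + \<beta> * int (Suc p) = (H p + \<beta> * int p) + (if f p = 1 then \<alpha> + \<beta> else 0)"
      by (simp add: algebra_simps)
    then show ?case using Suc by (simp only: dvd_add) simp
  qed simp
  then obtain k where k: "H p + \<beta> * int p = (\<alpha> + \<beta>) * k" ..
  have cop: "coprime (\<alpha> + \<beta>) \<beta>" using coprime by (simp add: coprime_iff_gcd_eq_1)
  show ?thesis
  proof
    assume "H p = 0"
    then have "(\<alpha> + \<beta>) dvd \<beta> * int p" using k by simp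
    then show "(\<alpha> + \<beta>) dvd int p" using cop by (simp add: coprime_dvd_mult_right_iff)
  next
    assume "(\<alpha> + \<beta>) dvd int p"
    then have "(\<alpha> + \<beta>) dvd (\<alpha> + \<beta>) * k - \<beta> * int p" by simp
    moreover have eq: "(\<alpha> + \<beta>) * k - \<beta> * int p = H p" unfolding k[symmetric] by simp
    ultimately have "(\<alpha> + \<beta>) dvd H p" unfolding eq by blast
    moreover have "\<bar>H p\<bar> < \<alpha> + \<beta>" using range[of p] pos by auto
    ultimately show "H p = 0" using dvd_imp_le_int[of "H p" "\<alpha> + \<beta>"] pos by linarith
  qed
qed

end

lemma walk_periodic:
  assumes "walk_word \<alpha> \<beta> 0 w" "height \<alpha> \<beta> w = 0" "w \<noteq> []" "\<alpha> > 0" "\<beta> > 0"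
  shows "walk (periodic w) \<alpha> \<beta>"
proof -
  have "if periodic w p = 1 then prefix_height (periodic w) \<alpha> \<beta> p \<le> 0
        else prefix_height (periodic w) \<alpha> \<beta> p \<ge> 0" for p
  proof -
    let ?i = "p mod length w"
    have i: "?i < length w" using assms(3) by simp
    have "prefix_height (periodic w) \<alpha> \<beta> p = height \<alpha> \<beta> (take ?i w)"
      using prefix_height_mod[OF assms(2), of p]
        prefix_height_take[OF occurs_at_periodic0, of ?i w \<alpha> \<beta>] i by simp
    moreover have "w ! ?i = periodic w p" by (simp add: periodic_def)
    ultimately show ?thesis using walk_word_nth[OF assms(1) i] by (simp only: add_0)
  qed
  then have "periodic w p = 1 \<Longrightarrow> prefix_height (periodic w) \<alpha> \<beta> p \<le> 0"
    "periodic w p = 0 \<Longrightarrow> prefix_height (periodic w) \<alpha> \<beta> p \<ge> 0" for p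
    by (metis, metis zero_neq_one)
  then show ?thesis using assms(4,5) by unfold_locales
qed

section \<open>Reversed standard words are walks\<close>

lemma word_power_singleton [simp]: "word_power [x] n = replicate n x"
  by (induction n) auto

text \<open>This adds one quotient to a continued fraction: counts \<open>(A, B)\<close> of zeros
  and ones become \<open>((e - 1) A + B, A)\<close>.\<close>

definition run_morphism :: "nat \<Rightarrow> word \<Rightarrow> word" where
  "run_morphism e v = concat (map (\<lambda>x. if x = 0 then 1 # replicate (e - 1) 0 else [0]) v)"

lemma run_morphism_simps [simp]:
  "run_morphism e [] = []"
  "run_morphism e (x # xs) = (if x = 0 then 1 # replicate (e - 1) 0 else [0]) @ run_morphism e xs"
  "run_morphism e (xs @ ys) = run_morphism e xs @ run_morphism e ys"
  by (simp_all add: run_morphism_def)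

lemma run_morphism_power: "run_morphism e (word_power v n) = word_power (run_morphism e v) n"
  by (induction n) auto

lemma run_morphism_zeros: "run_morphism e (replicate n 0) = word_power (1 # replicate (e - 1) 0) n"
  by (induction n) auto

lemma count_run_morphism:
  "count_list (run_morphism e v) 1 = count_list v 0"
  "count_list (run_morphism e v) 0 = (e - 1) * count_list v 0 + count_list v 1"
  by (induction v) (auto simp: count_list_replicate bit_not_one_iff bit_not_zero_iff)

lemma hd_run_morphism: "v \<noteq> [] \<Longrightarrow> hd (run_morphism e v) = hd v + 1"
  by (cases v) (auto simp: bit_not_zero_iff)

lemma walk_word_zeros:
  "\<beta> \<ge> 0 \<Longrightarrow> n = 0 \<or> h - int (n - 1) * \<beta> \<ge> 0 \<Longrightarrow> walk_word \<alpha> \<beta> h (replicate n 0)"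
proof (induction n arbitrary: h)
  case (Suc n)
  have "h \<ge> 0" using Suc.prems by (auto intro: order_trans[of 0 "int n * \<beta>"])
  moreover have "n = 0 \<or> (h - \<beta>) - int (n - 1) * \<beta> \<ge> 0"
    using Suc.prems by (cases n) (auto simp: algebra_simps)
  ultimately show ?case using Suc by simp
qed simp

text \<open>For the new slope, the image of 0 climbs by \<open>B\<close> and the image of 1 drops by
  \<open>A\<close>, so at block boundaries the old heights appear negated. Inside the image of 0,
  the height before its last zero, if there is one, is \<open>A + B - h\<close>, hence
  nonnegative.\<close>

lemma walk_word_run_morphism:
  assumes "e \<ge> 1" "A \<ge> 0" "B \<ge> 0" "walk_word A B h v" "- B \<le> h" "h \<le> A"
  shows "walk_word (int (e - 1) * A + B) A (- h) (run_morphism e v)"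
  using assms(4-)
proof (induction v arbitrary: h)
  case (Cons x xs)
  show ?case
  proof (cases "x = 0")
    case True
    then have h: "h \<ge> 0" "walk_word A B (h - B) xs" using Cons.prems by auto
    have IH: "walk_word (int (e - 1) * A + B) A (- (h - B)) (run_morphism e xs)"
      using Cons.IH[OF h(2)] h(1) Cons.prems assms by simp
    have "walk_word (int (e - 1) * A + B) A (- h + (int (e - 1) * A + B)) (replicate (e - 1) 0)"
    proof (rule walk_word_zeros)
      show "e - 1 = 0 \<or> - h + (int (e - 1) * A + B) - int (e - 1 - 1) * A \<ge> 0"
        using Cons.prems assms(3) by (cases "e - 1") (auto simp: algebra_simps)
    qed fact
    then show ?thesis using IH h True by (simp add: algebra_simps)
  next
    case False
    then have h: "h \<le> 0" "walk_word A B (h + A) xs" using Cons.prems by (auto simp: bit_not_zero_iff)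
    have "walk_word (int (e - 1) * A + B) A (- (h + A)) (run_morphism e xs)"
      using Cons.IH[OF h(2)] h(1) Cons.prems assms by simp
    then show ?thesis using h False by simp
  qed
qed simp

section \<open>Standard words and continued fractions\<close>

lemma standard_seq_cong:
  "(\<And>i. i \<ge> 1 \<Longrightarrow> d i = d' i) \<Longrightarrow> standard_seq d k = standard_seq d' k"
  by (induction d k rule: standard_seq.induct) auto

text \<open>The successor accounts for the exponent \<open>d 1 - 1\<close> in the first step of the recursion.\<close>

definition shift_directive :: "(nat \<Rightarrow> nat) \<Rightarrow> nat \<Rightarrow> nat" where
  "shift_directive d i = (if i = 1 then Suc (d 2) else d (Suc i))"

text \<open>Both sides satisfy the same recursion over two steps, since the morphism commutes with
  products and powers. Removing the first entry of \<open>d\<close> permits inductions on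
  \<open>k\<close> with varying \<open>d\<close>.\<close>

lemma rev_standard_seq_Suc:
  "rev (standard_seq d (Suc k)) = run_morphism (d 1) (rev (standard_seq (shift_directive d) k))"
proof (induction k rule: induct_nat_012)
  case 0
  show ?case by simp
next
  case 1
  show ?case
    by (simp add: rev_word_power run_morphism_power run_morphism_zeros shift_directive_def numeral_2_eq_2)
next
  case (ge2 k)
  then show ?case
    by (simp add: rev_word_power run_morphism_power shift_directive_def numeral_2_eq_2 del: standard_seq.simps(2))
qed

text \<open>Removing the first entry of \<open>d\<close> is a step of the Euclidean algorithm on the
  counts, so coprimality persists, and \<open>walk_word_run_morphism\<close> carries the walk over
  from height 0.\<close>

lemma reversed_standard_walk:
  assumes "\<And>i. i \<ge> 1 \<Longrightarrow> d i \<ge> 1" and "v = rev (standard_seq d k)"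
  shows "coprime (count_list v 0) (count_list v 1) \<and>
    walk_word (int (count_list v 0)) (int (count_list v 1)) 0 v"
  using assms
proof (induction k arbitrary: d v)
  case (Suc k)
  let ?u = "rev (standard_seq (shift_directive d) k)"
  have v: "v = run_morphism (d 1) ?u" using Suc.prems(2) rev_standard_seq_Suc by simp
  have d: "\<And>i. i \<ge> 1 \<Longrightarrow> shift_directive d i \<ge> 1" using Suc.prems(1) by (simp add: shift_directive_def)
  note IH = Suc.IH[OF d refl]
  have "coprime (count_list v 0) (count_list v 1)"
    using IH unfolding v count_run_morphism by (simp add: coprime_iff_gcd_eq_1 gcd.commute gcd_add_mult)
  moreover have "walk_word (int (d 1 - 1) * int (count_list ?u 0) + int (count_list ?u 1))
     (int (count_list ?u 0)) (- 0) v"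
    unfolding v using IH Suc.prems(1)[of 1] by (intro walk_word_run_morphism) auto
  ultimately show ?case unfolding v count_run_morphism by simp
qed simp

lemma standard_seq_1: "standard_seq d 1 = replicate (d 1 - 1) 0 @ [1]"
  by simp

lemma count_zero_standard_seq: "d 1 \<ge> 2 \<Longrightarrow> (\<And>i. i \<ge> 1 \<Longrightarrow> d i \<ge> 1) \<Longrightarrow> count_list (standard_seq d k) 0 \<ge> 1"
proof (induction k rule: induct_nat_012)
  case (ge2 n)
  then show ?case by (simp add: trans_le_add2)
qed (auto simp: count_list_replicate)

lemma standard_seq_2: "standard_seq d 2 = word_power (replicate (d 1 - 1) 0 @ [1]) (d 2) @ [0]"
  using standard_seq_1[of d] by (simp add: numeral_2_eq_2)

text \<open>The sequence \<open>d\<close> is the continued fraction of A/B, built by the Euclidean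
  algorithm. Both first letters are available because the expansion can end in two ways. As this
  alters the last quotients, \<open>d 1\<close> and \<open>d 2\<close> are specified only if the
  algorithm goes on beyond them.\<close>

lemma exists_reversed_standard_params:
  assumes "coprime A B" "B \<ge> 1" "B < A"
  shows "\<exists>d k. (\<forall>i\<ge>1. d i \<ge> 1) \<and> d 1 \<ge> 2 \<and> (B \<ge> 2 \<longrightarrow> d 1 = A div B + 1) \<and>
    (A mod B \<ge> 2 \<longrightarrow> d 2 = B div (A mod B)) \<and>
    count_list (rev (standard_seq d k)) 0 = A \<and> count_list (rev (standard_seq d k)) 1 = B \<and>
    hd (rev (standard_seq d k)) = (x::bit)"
  using assms
proof (induction B arbitrary: A x rule: less_induct)
  case (less B)
  show ?case
  proof (cases "B = 1")
    case True
    show ?thesis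
    proof (cases "x = 1")
      case x: True
      show ?thesis
        by (rule exI[of _ "\<lambda>i. if i = 1 then A + 1 else 1"], rule exI[of _ 1], unfold standard_seq_1)
          (use less.prems x True in \<open>auto simp: count_list_replicate\<close>)
    next
      case x: False
      show ?thesis
        by (rule exI[of _ "\<lambda>i. if i = 1 then A else 1"], rule exI[of _ 2], unfold standard_seq_2)
          (use less.prems x True in \<open>auto simp: count_list_replicate bit_not_one_iff\<close>)
    qed
  next
    case False
    then have B: "B \<ge> 2" using less.prems by simp
    define l where "l = A mod B"
    have l: "l < B" "coprime B l" using less.prems B by (auto simp: l_def coprime_commute)
    have l1: "l \<ge> 1" using l B by (cases l) auto
    \<comment> \<open>The letter is complemented because \<open>run_morphism\<close> complements the
      first letter.\<close>
    obtain d k where d: "\<forall>i\<ge>1. d i \<ge> 1" "d 1 \<ge> 2" "l \<ge> 2 \<longrightarrow> d 1 = B div l + 1"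
      and c: "count_list (rev (standard_seq d k)) 0 = B" "count_list (rev (standard_seq d k)) 1 = l"
      "hd (rev (standard_seq d k)) = x + 1"
      using less.IH[OF l(1) l(2) l1 l(1), of "x + 1"] by auto
    \<comment> \<open>The new quotient is put in front. \<open>d 1 - 1\<close> cancels the successor
      in \<open>shift_directive\<close>, and \<open>d 1 \<ge> 2\<close> keeps this entry
      positive.\<close>
    define D where "D = (\<lambda>i. if i = 1 then A div B + 1 else if i = 2 then d 1 - 1 else d (i - 1))"
    have eq: "standard_seq (shift_directive D) k = standard_seq d k"
      by (rule standard_seq_cong) (use d in \<open>auto simp: shift_directive_def D_def\<close>)
    have D: "rev (standard_seq D (Suc k)) = run_morphism (A div B + 1) (rev (standard_seq d k))"
      unfolding rev_standard_seq_Suc eq by (simp add: D_def)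
    have ne: "rev (standard_seq d k) \<noteq> []" using c(1) B by (metis count_list.simps(1) not_numeral_le_zero)
    have "A div B \<ge> 1" using less.prems by (simp add: div_greater_zero_iff Suc_le_eq)
    then have "(\<forall>i\<ge>1. D i \<ge> 1) \<and> D 1 \<ge> 2 \<and> (B \<ge> 2 \<longrightarrow> D 1 = A div B + 1) \<and>
      (A mod B \<ge> 2 \<longrightarrow> D 2 = B div (A mod B))"
      using d by (auto simp: D_def l_def[symmetric])
    moreover have "count_list (rev (standard_seq D (Suc k))) 1 = B"
      unfolding D count_run_morphism by (rule c)
    moreover have "count_list (rev (standard_seq D (Suc k))) 0 = A"
      unfolding D count_run_morphism c by (simp add: l_def)
    moreover have "hd (rev (standard_seq D (Suc k))) = x"
      unfolding D hd_run_morphism[OF ne] c by (simp add: add.assoc)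
    ultimately show ?thesis by blast
  qed
qed

text \<open>Adds the case A = B = 1 and reads the parameters off the quotients:
  \<open>0 < r < l\<close> makes \<open>l\<close> and B at least 2, so the previous lemma determines
  \<open>d 1\<close> and \<open>d 2\<close>.\<close>

lemma exists_reversed_standard:
  assumes "coprime A B" "B \<ge> 1" "B \<le> A"
  shows "\<exists>v. reversed_standard_word v \<and> count_list v 0 = A \<and> count_list v 1 = B \<and> hd v = x \<and>
    walk_word (int A) (int B) 0 v \<and>
    (\<forall>a b l r. A = a * B + l \<and> B = (b + 1) * l + r \<and> 0 < r \<and> r < l \<longrightarrow> reversed_standard_word_with a b v)"
proof -
  have "\<exists>d k. (\<forall>i\<ge>1. d i \<ge> 1) \<and> (B < A \<longrightarrow> (B \<ge> 2 \<longrightarrow> d 1 = A div B + 1) \<and>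
    (A mod B \<ge> 2 \<longrightarrow> d 2 = B div (A mod B))) \<and>
    count_list (rev (standard_seq d k)) 0 = A \<and> count_list (rev (standard_seq d k)) 1 = B \<and>
    hd (rev (standard_seq d k)) = x"
  proof (cases "B < A")
    case True
    then show ?thesis using exists_reversed_standard_params[OF assms(1,2) True, of x] by blast
  next
    case False
    then have AB: "A = 1" "B = 1" using assms by auto
    show ?thesis
    proof (cases "x = 1")
      case x: True
      show ?thesis
        by (rule exI[of _ "\<lambda>i. 2"], rule exI[of _ 1], unfold standard_seq_1)
          (use AB x in \<open>auto simp: count_list_replicate\<close>)
    next
      case x: False
      show ?thesis
        by (rule exI[of _ "\<lambda>i. 1"], rule exI[of _ 2], unfold standard_seq_2)
          (use AB x in \<open>auto simp: count_list_replicate bit_not_one_iff\<close>)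
    qed
  qed
  then obtain d k where d: "\<forall>i\<ge>1. d i \<ge> 1"
    "B < A \<longrightarrow> (B \<ge> 2 \<longrightarrow> d 1 = A div B + 1) \<and> (A mod B \<ge> 2 \<longrightarrow> d 2 = B div (A mod B))"
    and c: "count_list (rev (standard_seq d k)) 0 = A" "count_list (rev (standard_seq d k)) 1 = B"
      "hd (rev (standard_seq d k)) = x" by blast
  let ?v = "rev (standard_seq d k)"
  have "reversed_standard_word ?v"
    using d(1) by (auto simp: reversed_standard_word_def standard_word_def)
  moreover have "walk_word (int A) (int B) 0 ?v"
    using reversed_standard_walk[of d ?v k] d(1) unfolding c by simp
  moreover have "reversed_standard_word_with a b ?v"
    if "A = a * B + l" "B = (b + 1) * l + r" "0 < r" "r < l" for a b l r
  proof -
    have lB: "l < B" using that by (simp add: that(2))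
    have "a \<ge> 1" using that(1) lB assms(3) by (cases a) auto
    then have "B < A" using that lB by (cases a) auto
    moreover have "A div B = a" "A mod B = l" "B div l = b + 1"
      using that lB by (simp_all add: that(1) div_mult_self3 mod_mult_self3) (simp add: div_nat_eqI algebra_simps)
    ultimately show ?thesis using d that lB
      by (auto simp: reversed_standard_word_with_def intro!: exI[of _ d] exI[of _ k])
  qed
  ultimately show ?thesis using c by blast
qed

text \<open>The length bound forces \<open>k \<ge> 3\<close>, so \<open>v\<close> is a double image
  under \<open>run_morphism\<close>, and \<open>l\<close>, \<open>r\<close> are the letter counts of
  the preimage \<open>u\<close>. They are coprime, so \<open>l = r\<close> would make both 1 and
  give exactly the length of \<open>S6 a b\<close>.\<close>

lemma reversed_standard_word_with_counts:
  assumes "reversed_standard_word_with a b v" "length v > length (S6 a b)"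
  shows "\<exists>l r. count_list v 0 = a * count_list v 1 + l \<and> count_list v 1 = (b + 1) * l + r \<and> 0 < r \<and> r < l"
proof -
  obtain d k where d: "\<And>i. i \<ge> 1 \<Longrightarrow> d i \<ge> 1" "d 1 = a + 1" "d 2 = b + 1"
    and v: "v = rev (standard_seq d k)"
    using assms(1) by (auto simp: reversed_standard_word_with_def)
  have len: "length (S6 a b) = (b + 2) * (a + 1) + 1" by (simp add: S6_def)
  have "length (standard_seq d 1) = a + 1" "length (standard_seq d 2) = (a + 1) * (b + 1) + 1"
    unfolding standard_seq_1 standard_seq_2 using d(2,3) by (simp_all add: algebra_simps)
  then have "k \<noteq> 1" "k \<noteq> 2" using assms(2) v by (auto simp: len simp del: standard_seq.simps)
  moreover have "k \<noteq> 0" using assms(2) v by (cases k) (auto simp: len)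
  ultimately obtain n where k: "k = Suc (Suc (Suc n))"
    by (metis One_nat_def Suc_1 not0_implies_Suc)
  define d2 where "d2 = shift_directive (shift_directive d)"
  have d2: "\<And>i. i \<ge> 1 \<Longrightarrow> d2 i \<ge> 1" "d2 1 \<ge> 2" using d by (auto simp: d2_def shift_directive_def)
  define u where "u = rev (standard_seq d2 (Suc n))"
  define t where "t = rev (standard_seq (shift_directive d2) n)"
  have u: "u = run_morphism (d2 1) t" unfolding u_def t_def by (rule rev_standard_seq_Suc)
  have v2: "v = run_morphism (a + 1) (run_morphism (b + 2) u)"
    unfolding v k rev_standard_seq_Suc[of d] rev_standard_seq_Suc[of "shift_directive d"] u_def d2_def
    using d by (simp add: shift_directive_def)
  have cop: "coprime (count_list u 0) (count_list u 1)"
    using reversed_standard_walk[of d2 u "Suc n"] d2 u_def by blast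
  have t0: "count_list t 0 \<ge> 1"
    unfolding t_def using count_zero_standard_seq[of "shift_directive d2" n] d2
    by (simp add: shift_directive_def)
  have "1 * count_list t 0 \<le> (d2 1 - 1) * count_list t 0" using d2(2) by (intro mult_le_mono1) auto
  then have "count_list u 0 \<ge> count_list u 1"
    unfolding u count_run_morphism by linarith
  moreover have "count_list u 1 \<ge> 1" unfolding u count_run_morphism by (rule t0)
  moreover have "count_list u 0 \<noteq> count_list u 1"
  proof
    assume "count_list u 0 = count_list u 1"
    then have "count_list u 0 = 1" "count_list u 1 = 1" using cop by auto
    then have "length v = (b + 2) * (a + 1) + 1"
      unfolding length_bit_word v2 count_run_morphism by (simp add: algebra_simps)
    then show False using assms(2) unfolding len by simp
  qed
  ultimately show ?thesis unfolding v2 count_run_morphism by auto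
qed

section \<open>Solutions are walks\<close>

lemma height_min_square_roots:
  assumes "a \<ge> 1"
  shows "height \<alpha> \<beta> S1 = - \<beta>"
    "height \<alpha> \<beta> (S2 a) = \<alpha> - int a * \<beta>"
    "height \<alpha> \<beta> (S3 a) = \<alpha> - int a * \<beta> - \<beta>"
    "height \<alpha> \<beta> (S4 a) = \<alpha> - int a * \<beta>"
    "height \<alpha> \<beta> (S5 a b) = \<alpha> - int a * \<beta> - \<beta> + int b * (\<alpha> - int a * \<beta>)"
    "height \<alpha> \<beta> (S6 a b) = \<alpha> - int a * \<beta> - \<beta> + int (b + 1) * (\<alpha> - int a * \<beta>)"
  using assms by (auto simp: S1_def S2_def S3_def S4_def S5_def S6_def algebra_simps of_nat_diff)

lemma height_take_power:
  assumes "\<beta> > 0" "\<alpha> \<ge> int a * \<beta>"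
  shows "0 \<le> height \<alpha> \<beta> (take i (word_power ([1] @ replicate a 0) c)) \<and>
    height \<alpha> \<beta> (take i (word_power ([1] @ replicate a 0) c)) \<le> \<alpha> + int c * (\<alpha> - int a * \<beta>)"
proof (induction c arbitrary: i)
  case 0
  then show ?case using assms by (simp add: order_trans[of 0 "int a * \<beta>"])
next
  case (Suc c)
  have \<alpha>0: "\<alpha> \<ge> 0" using assms by (simp add: order_trans[of 0 "int a * \<beta>"])
  show ?case
  proof (cases "i \<le> a + 1")
    case True
    define y where "y = \<beta> * int (i - 1)"
    define z where "z = int c * (\<alpha> - int a * \<beta>)"
    have "y \<le> \<beta> * int a" unfolding y_def using True assms by (intro mult_left_mono) auto
    then have "y \<le> \<alpha>" using assms mult.commute[of \<beta> "int a"] by linarith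
    moreover have "y \<ge> 0" "z \<ge> 0" using assms by (simp_all add: y_def z_def)
    moreover have "int (Suc c) * (\<alpha> - int a * \<beta>) = z + (\<alpha> - int a * \<beta>)"
      by (simp add: z_def algebra_simps)
    moreover have "take i (word_power ([1] @ replicate a (0::bit)) (Suc c)) = (if i = 0 then [] else 1 # replicate (i - 1) 0)"
      using True by (auto simp: take_Cons' min_def)
    then have "height \<alpha> \<beta> (take i (word_power ([1] @ replicate a 0) (Suc c))) =
        (if i = 0 then 0 else height \<alpha> \<beta> (1 # replicate (i - 1) 0))" by (cases "i = 0") simp_all
    moreover have "height \<alpha> \<beta> (1 # replicate (i - 1) 0) = \<alpha> - y" by (simp add: y_def)
    ultimately show ?thesis using assms \<alpha>0 by presburger
  next
    case False
    then have "take i (word_power ([1] @ replicate a (0::bit)) (Suc c))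
      = ([1] @ replicate a 0) @ take (i - (a + 1)) (word_power ([1] @ replicate a 0) c)"
      by (simp add: take_Cons')
    then show ?thesis using Suc.IH[of "i - (a + 1)"] assms by (simp add: algebra_simps)
  qed
qed

text \<open>Apart from the start, the lowest point comes after the long run, at \<alpha> -
  (a+1)\<beta>. The first peak is \<alpha>; the later ones are bounded relative to the end of
  \<open>X\<close>.\<close>

lemma height_take_long_root:
  assumes "\<beta> > 0" "\<alpha> \<ge> int a * \<beta>"
    and X: "X = [1] @ replicate (a + 1) 0 @ word_power ([1] @ replicate a 0) c"
  shows "- \<beta> \<le> height \<alpha> \<beta> (take i X) \<and>
    (height \<alpha> \<beta> (take i X) \<le> \<alpha> \<or> height \<alpha> \<beta> (take i X) \<le> \<alpha> + height \<alpha> \<beta> X)"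
proof (cases "i \<le> a + 2")
  case True
  have "int (i - 1) * \<beta> \<le> int (a + 1) * \<beta>" using True assms by (intro mult_right_mono) auto
  moreover have "\<alpha> \<ge> 0" using assms by (simp add: order_trans[of 0 "int a * \<beta>"])
  moreover have "0 \<le> \<beta> * int (i - 1)" using assms by simp
  moreover have "take i X = (if i = 0 then [] else 1 # replicate (i - 1) 0)"
    using True by (auto simp: X take_Cons' min_def simp flip: replicate_Suc)
  ultimately show ?thesis using assms(1,2) by (auto simp: algebra_simps)
next
  case False
  then have "take i X = ([1] @ replicate (a + 1) 0) @ take (i - (a + 2)) (word_power ([1] @ replicate a 0) c)"
    by (simp add: X take_Cons' numeral_2_eq_2)
  then show ?thesis using height_take_power[OF assms(1,2), of "i - (a + 2)" c] assms
    by (simp add: algebra_simps)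
qed

text \<open>The disjunction is tailored to \<open>walk_from_double_steps\<close>, where both ends of
  \<open>X\<close> have height at most 0, so that either alternative bounds an interior height by
  \<alpha>.\<close>

lemma height_take_min_square_root:
  assumes "a \<ge> 1" "\<beta> > 0" "\<alpha> \<ge> int a * \<beta>" "X \<in> min_square_roots a b"
  shows "- \<beta> \<le> height \<alpha> \<beta> (take i X) \<and>
    (height \<alpha> \<beta> (take i X) \<le> \<alpha> \<or> height \<alpha> \<beta> (take i X) \<le> \<alpha> + height \<alpha> \<beta> X)"
proof -
  have \<alpha>0: "\<alpha> \<ge> 0" using assms by (simp add: order_trans[of 0 "int a * \<beta>"])
  have R: "- \<beta> \<le> height \<alpha> \<beta> (take i (1 # replicate n 0)) \<and> height \<alpha> \<beta> (take i (1 # replicate n 0)) \<le> \<alpha>"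
    if "n \<le> a" for n i
  proof -
    have "\<beta> * int (min (i - 1) n) \<le> \<beta> * int a" using that assms by (intro mult_left_mono) auto
    then have "\<beta> * int (min (i - 1) n) \<le> \<alpha>" using assms mult.commute[of \<beta> "int a"] by linarith
    moreover have "\<beta> * int (min (i - 1) n) \<ge> 0" using assms by simp
    ultimately show ?thesis using assms \<alpha>0 by (auto simp: take_Cons' algebra_simps numeral_2_eq_2)
  qed
  have T: "- \<beta> \<le> height \<alpha> \<beta> (take i (0 # 1 # replicate n 0)) \<and> height \<alpha> \<beta> (take i (0 # 1 # replicate n 0)) \<le> \<alpha>"
    if "n \<le> a" for n
  proof -
    have "\<beta> * int (min (i - 2) n) \<le> \<beta> * int a" using that assms by (intro mult_left_mono) auto
    then have "\<beta> * int (min (i - 2) n) \<le> \<alpha>" using assms mult.commute[of \<beta> "int a"] by linarith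
    moreover have "\<beta> * int (min (i - 2) n) \<ge> 0" using assms by simp
    ultimately show ?thesis using assms \<alpha>0 by (auto simp: take_Cons' algebra_simps numeral_2_eq_2)
  qed
  from assms(4) consider "X = S1" | "X = S2 a" | "X = S3 a" | "X = S4 a" | "X = S5 a b" | "X = S6 a b"
    by (auto simp: min_square_roots_def)
  then show ?thesis
  proof cases
    case 1
    then show ?thesis using assms \<alpha>0 by (cases i) (auto simp: S1_def)
  next
    case 2
    then show ?thesis using T[of "a - 1"] by (auto simp: S2_def)
  next
    case 3
    then show ?thesis using T[of a] by (auto simp: S3_def)
  next
    case 4
    then show ?thesis using R[of a] by (auto simp: S4_def)
  next
    case 5
    then show ?thesis using height_take_long_root[OF assms(2,3), of X b] by (auto simp: S5_def)
  next
    case 6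
    then show ?thesis using height_take_long_root[OF assms(2,3), of X "b + 1"] by (auto simp: S6_def)
  qed
qed

section \<open>Factors paired with their squares\<close>

definition double_step :: "nat \<Rightarrow> nat \<Rightarrow> (nat \<Rightarrow> bit) \<Rightarrow> int \<Rightarrow> int \<Rightarrow> nat \<Rightarrow> word \<Rightarrow> bool" where
  "double_step a b f \<alpha> \<beta> t X \<longleftrightarrow> X \<in> min_square_roots a b \<and> occurs_at f t X \<and>
     occurs_at f (2 * t) X \<and> occurs_at f (2 * t + length X) X \<and>
     prefix_height f \<alpha> \<beta> (2 * t) = 2 * prefix_height f \<alpha> \<beta> t"

text \<open>The three copies of \<open>X\<close> have the same partial sums, so moving
  \<open>p\<close> by \<open>t\<close>, or by the end position of \<open>X\<close>, adds a constant
  to \<open>H\<close>. The doubling at \<open>t\<close> identifies this constant.\<close>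

lemma double_step_height:
  assumes "double_step a b f \<alpha> \<beta> t X" "t \<le> p" "p \<le> t + length X"
  shows "prefix_height f \<alpha> \<beta> (p + t) = prefix_height f \<alpha> \<beta> p + prefix_height f \<alpha> \<beta> t"
    "prefix_height f \<alpha> \<beta> (p + (t + length X)) =
       prefix_height f \<alpha> \<beta> p + prefix_height f \<alpha> \<beta> (t + length X)"
proof -
  obtain i where i: "p = t + i" "i \<le> length X" using assms(2,3) by (metis add_le_cancel_left le_Suc_ex)
  have s: "occurs_at f t X" "occurs_at f (2 * t) X" "occurs_at f (2 * t + length X) X"
    "prefix_height f \<alpha> \<beta> (2 * t) = 2 * prefix_height f \<alpha> \<beta> t"
    using assms(1) by (auto simp: double_step_def)
  note T = prefix_height_take[OF _ i(2), of f _ \<alpha> \<beta>]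
  have eq: "p + t = 2 * t + i" "p + (t + length X) = 2 * t + length X + i" using i by auto
  show "prefix_height f \<alpha> \<beta> (p + t) = prefix_height f \<alpha> \<beta> p + prefix_height f \<alpha> \<beta> t"
    "prefix_height f \<alpha> \<beta> (p + (t + length X)) =
       prefix_height f \<alpha> \<beta> p + prefix_height f \<alpha> \<beta> (t + length X)"
    unfolding eq using T[OF s(1)] T[OF s(2)] T[OF s(3)] prefix_height_occurs[OF s(1), of \<alpha> \<beta>]
      prefix_height_occurs[OF s(2), of \<alpha> \<beta>] s(4) i(1) by simp_all
qed

lemma double_step_letter:
  assumes "double_step a b f \<alpha> \<beta> t X" "t \<le> p" "p < t + length X"
  shows "f (p + t) = f p" "f (p + (t + length X)) = f p"
proof -
  obtain i where i: "p = t + i" "i < length X" using assms(2,3) by (metis add_less_cancel_left le_Suc_ex)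
  then have eq: "p + t = 2 * t + i" "p + (t + length X) = 2 * t + length X + i" by auto
  have "f (t + i) = X ! i" "f (2 * t + i) = X ! i" "f (2 * t + length X + i) = X ! i"
    using assms(1) i by (auto simp: double_step_def occurs_at_iff)
  then show "f (p + t) = f p" "f (p + (t + length X)) = f p" unfolding eq unfolding i by simp_all
qed

text \<open>At a maximum \<open>p\<close>, \<open>H (p + t) \<le> H p\<close> and additivity give
  \<open>H t \<le> 0\<close>, and likewise at the right end of the factor; a minimum is treated with
  the left end alone. Once \<open>H\<close> lies between -\<beta> and \<alpha>, a 1 at positive
  height or a 0 at negative height would leave this range.\<close>

lemma walk_from_double_steps:
  assumes "a \<ge> 1" "\<alpha> > 0" "\<beta> > 0" "\<alpha> \<ge> int a * \<beta>" "N > 0"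
    and per: "\<And>p. prefix_height f \<alpha> \<beta> (p + N) = prefix_height f \<alpha> \<beta> p"
    and cover: "\<And>p. p < N \<Longrightarrow> \<exists>t X. double_step a b f \<alpha> \<beta> t X \<and> t \<le> p \<and> p < t + length X"
  shows "walk f \<alpha> \<beta>"
proof -
  let ?H = "prefix_height f \<alpha> \<beta>"
  \<comment> \<open>Periodicity lets the extrema be taken over 1..N; for \<open>p\<close> in this
    range \<open>cover\<close> applies to \<open>p - 1\<close>.\<close>
  have reduce: "\<exists>q. 0 < q \<and> q \<le> N \<and> ?H q = ?H p" for p
  proof (induction p rule: less_induct)
    case (less p)
    show ?case
    proof (cases "p \<le> N")
      case True
      then show ?thesis using per[of 0] assms(5) by (cases "p = 0") auto
    next
      case False
      then show ?thesis using less[of "p - N"] per[of "p - N"] assms(5) by auto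
    qed
  qed
  have fin: "finite (?H ` {0<..N})" "?H ` {0<..N} \<noteq> {}" using assms(5) by auto
  obtain p where p: "0 < p" "p \<le> N" "?H p = Max (?H ` {0<..N})"
    using Max_in[OF fin] by auto
  have max: "?H q \<le> ?H p" for q
    using reduce[of q] Max_ge[OF fin(1)] p(3) by (metis greaterThanAtMost_iff imageI)
  obtain p' where p': "0 < p'" "p' \<le> N" "?H p' = Min (?H ` {0<..N})"
    using Min_in[OF fin] by auto
  have min: "?H p' \<le> ?H q" for q
    using reduce[of q] Min_le[OF fin(1)] p'(3) by (metis greaterThanAtMost_iff imageI)
  have upper: "?H p \<le> \<alpha>"
  proof -
    obtain t X where s: "double_step a b f \<alpha> \<beta> t X" "t \<le> p - 1" "p - 1 < t + length X"
      using cover[of "p - 1"] p(1,2) by (metis One_nat_def Suc_le_lessD Suc_pred)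
    then have b: "t \<le> p" "p \<le> t + length X" using p by auto
    have "?H t \<le> 0" "?H (t + length X) \<le> 0"
      using double_step_height[OF s(1) b] max[of "p + t"] max[of "p + (t + length X)"] by auto
    moreover have o: "occurs_at f t X" and X: "X \<in> min_square_roots a b" using s(1) by (auto simp: double_step_def)
    moreover have "?H p = ?H t + height \<alpha> \<beta> (take (p - t) X)"
      using prefix_height_take[OF o, of "p - t" \<alpha> \<beta>] b by simp
    moreover have "?H (t + length X) = ?H t + height \<alpha> \<beta> X" using prefix_height_occurs[OF o] .
    ultimately show ?thesis using height_take_min_square_root[OF assms(1,3,4) X, of "p - t"] by linarith
  qed
  have lower: "- \<beta> \<le> ?H p'"
  proof -
    obtain t X where s: "double_step a b f \<alpha> \<beta> t X" "t \<le> p' - 1" "p' - 1 < t + length X"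
      using cover[of "p' - 1"] p'(1,2) by (metis One_nat_def Suc_le_lessD Suc_pred)
    then have b: "t \<le> p'" "p' \<le> t + length X" using p' by auto
    have "?H t \<ge> 0" using double_step_height(1)[OF s(1) b] min[of "p' + t"] by auto
    moreover have o: "occurs_at f t X" and X: "X \<in> min_square_roots a b" using s(1) by (auto simp: double_step_def)
    moreover have "?H p' = ?H t + height \<alpha> \<beta> (take (p' - t) X)"
      using prefix_height_take[OF o, of "p' - t" \<alpha> \<beta>] b by simp
    ultimately show ?thesis using height_take_min_square_root[OF assms(1,3,4) X, of "p' - t"] by linarith
  qed
  show ?thesis
  proof
    fix q
    show "?H q \<le> 0" if "f q = 1" using max[of "Suc q"] upper that by simp
    show "?H q \<ge> 0" if "f q = 0" using min[of "Suc q"] lower that by simp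
  qed fact+
qed

text \<open>In front of a 1, at least one whole block remains, and each has height \<alpha> -
  a\<beta>. In front of a 0, the current block still lacks a zero, which leaves it at least \<beta>
  above its final height.\<close>

lemma height_power_letter:
  assumes "\<beta> > 0" "\<alpha> \<ge> int a * \<beta>" "j < length (word_power ([1] @ replicate a (0::bit)) c)"
  shows "(word_power ([1] @ replicate a (0::bit)) c ! j = 1 \<longrightarrow>
      height \<alpha> \<beta> (drop j (word_power ([1] @ replicate a (0::bit)) c)) \<ge> \<alpha> - int a * \<beta>) \<and>
    (word_power ([1] @ replicate a (0::bit)) c ! j \<noteq> 1 \<longrightarrow>
      height \<alpha> \<beta> (take j (word_power ([1] @ replicate a (0::bit)) c)) \<ge> \<alpha> - int a * \<beta> + \<beta>)"
  using assms(3)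
proof (induction c arbitrary: j)
  case 0
  then show ?case by simp
next
  case (Suc c)
  let ?R = "[1] @ replicate a (0::bit)"
  have cl: "int c * (\<alpha> - int a * \<beta>) \<ge> 0" using assms by simp
  consider "j = 0" | "1 \<le> j" "j \<le> a" | "j \<ge> a + 1" by linarith
  then show ?case
  proof cases
    case 1
    then show ?thesis using cl by (simp add: algebra_simps)
  next
    case 2
    have eq: "take j (word_power ?R (Suc c)) = 1 # replicate (j - 1) 0"
      using 2 by (auto simp: take_Cons' min_def)
    have n: "word_power ?R (Suc c) ! j \<noteq> 1" using 2 by (auto simp: nth_append nth_Cons')
    have "\<beta> * int j \<le> \<beta> * int a" using 2 assms by (intro mult_left_mono) auto
    then have "height \<alpha> \<beta> (take j (word_power ?R (Suc c))) \<ge> \<alpha> - int a * \<beta> + \<beta>"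
      unfolding eq using 2 by (simp add: algebra_simps of_nat_diff)
    then show ?thesis using n by blast
  next
    case 3
    then have "take j (word_power ?R (Suc c)) = ?R @ take (j - (a + 1)) (word_power ?R c)"
      "drop j (word_power ?R (Suc c)) = drop (j - (a + 1)) (word_power ?R c)"
      "word_power ?R (Suc c) ! j = word_power ?R c ! (j - (a + 1))"
      by (auto simp: take_Cons' drop_Cons' nth_append nth_Cons')
    moreover have "j - (a + 1) < length (word_power ?R c)" using 3 Suc.prems by simp
    ultimately show ?thesis using Suc.IH[of "j - (a + 1)"] assms(2)
      by (simp only: height_simps) auto
  qed
qed

context walk
begin

text \<open>At an interior zero \<open>p\<close>, additivity makes \<open>H t\<close> and the height
  at the end of \<open>X\<close> reappear at \<open>p + t\<close> and
  \<open>p + (t + length X)\<close>, where the letter is \<open>f p\<close> again. So the walk rule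
  fixes their signs, against the shape of each root. For \<alpha> = a\<beta> the runs
  \<open>1 0^a\<close> have height 0, and the argument breaks down for \<open>S5\<close> and
  \<open>S6\<close>.\<close>

lemma no_interior_zero:
  assumes "a \<ge> 1" "\<alpha> \<ge> int a * \<beta>" "double_step a b f \<alpha> \<beta> t X" "t < p" "p < t + length X"
    and l0: "\<alpha> = int a * \<beta> \<Longrightarrow> X \<noteq> S5 a b \<and> X \<noteq> S6 a b"
  shows "H p \<noteq> 0"
proof
  assume Hp: "H p = 0"
  obtain i where i: "p = t + i" "0 < i" "i < length X"
    using assms(4,5) by (metis add_less_cancel_left less_imp_add_positive)
  have X: "X \<in> min_square_roots a b" and o: "occurs_at f t X" using assms(3) by (auto simp: double_step_def)
  have let_p: "f p = X ! i" and let_t: "f t = X ! 0"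
    using o i by (auto simp: occurs_at_iff dest: spec[of _ 0])
  have Ht: "H t + height \<alpha> \<beta> (take i X) = 0"
    using prefix_height_take[OF o, of i \<alpha> \<beta>] i Hp by simp
  have "height \<alpha> \<beta> X = height \<alpha> \<beta> (take i X) + height \<alpha> \<beta> (drop i X)"
    by (metis append_take_drop_id height_simps(3))
  then have Ht': "H (t + length X) = height \<alpha> \<beta> (drop i X)"
    using Ht prefix_height_occurs[OF o, of \<alpha> \<beta>] by simp
  have b: "t \<le> p" "p \<le> t + length X" using assms by auto
  note shift = double_step_height[OF assms(3) b] double_step_letter[OF assms(3) b(1) assms(5)]
  have L1: "H t \<le> 0 \<and> H (t + length X) \<le> 0" if "f p = 1"
    using that one[of "p + t"] one[of "p + (t + length X)"] shift Hp by simp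
  have L0: "H t \<ge> 0 \<and> H (t + length X) \<ge> 0" if "f p = 0"
    using that zero[of "p + t"] zero[of "p + (t + length X)"] shift Hp by simp
  \<comment> \<open>A tail of zeros has negative height, but the letter 0 at \<open>p\<close>
    demands a nonnegative height at the end of \<open>X\<close>.\<close>
  have last_zeros: False if "drop i X = replicate (Suc k) 0" for k
  proof -
    have "X ! i = 0" using that i(3) by (metis Cons_nth_drop_Suc list.inject replicate_Suc)
    then have "height \<alpha> \<beta> (drop i X) \<ge> 0" using L0 let_p Ht' by simp
    then show False unfolding that height_simps using pos by (simp add: mult_le_0_iff)
  qed
  \<comment> \<open>If \<open>p\<close> carries the 1, then \<open>H t = \<beta>\<close>, against
    \<open>L1\<close>. Any later interior position has only zeros from there on.\<close>
  have start_0: False if "X = 0 # 1 # replicate n 0" for n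
  proof (cases "i = 1")
    case True
    then show False using that L1 Ht let_p pos by simp
  next
    case False
    then have "drop i X = replicate (Suc (n - (i - 1))) 0"
      using i that by (cases i) (auto simp: drop_Cons' simp flip: replicate_Suc)
    then show False using last_zeros by blast
  qed
  have long: False if X: "X = [1] @ replicate (a + 1) 0 @ word_power ([1] @ replicate a 0) c"
    and l: "\<alpha> > int a * \<beta>" for c
  proof -
    have "f t = 1" using let_t X by simp
    then have Ht0: "H t \<le> 0" by (rule one)
    show False
    proof (cases "i \<le> a + 1")
      \<comment> \<open>In the long run \<open>H t\<close> is squeezed to 0, while the part of
        \<open>X\<close> before \<open>p\<close> has height at least \<alpha> - a\<beta> >
        0.\<close>
      case True
      have "X ! i = 0" using X True i(2) by (auto simp: nth_append nth_Cons' simp flip: replicate_Suc)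
      then have "height \<alpha> \<beta> (take i X) = 0" using L0 let_p Ht Ht0 by simp
      moreover have "take i X = 1 # replicate (i - 1) 0"
        using True i(2) by (auto simp: X take_Cons' min_def simp flip: replicate_Suc)
      moreover have "\<beta> * int (i - 1) \<le> \<beta> * int a" using True pos by (intro mult_left_mono) auto
      ultimately show False using l mult.commute[of \<beta> "int a"] by simp
    next
      case False
      define j where "j = i - (a + 2)"
      let ?P = "word_power ([1] @ replicate a 0) c :: word"
      have eq: "take i X = ([1] @ replicate (a + 1) 0) @ take j ?P" "drop i X = drop j ?P"
        "X ! i = ?P ! j"
        using False by (auto simp: X j_def take_Cons' drop_Cons' nth_append nth_Cons' numeral_2_eq_2)
      have j: "j < length ?P" using i(3) False by (simp add: X j_def)
      show False
      \<comment> \<open>In the short runs, a 1 leaves a part of positive height, against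
        \<open>L1\<close>; a 0 comes after a part of positive height, so \<open>H t\<close> is
        negative, against \<open>L0\<close>.\<close>
      proof (cases "?P ! j = 1")
        case True
        then have "height \<alpha> \<beta> (drop j ?P) > 0"
          using height_power_letter[OF pos(2) assms(2) j] l by (auto intro: less_le_trans[rotated])
        then show False using L1 let_p Ht' eq True by simp
      next
        case False
        then have "height \<alpha> \<beta> (take j ?P) \<ge> \<alpha> - int a * \<beta> + \<beta>"
          using height_power_letter[OF pos(2) assms(2) j] l by (auto intro: less_le_trans[rotated])
        then have "height \<alpha> \<beta> (take i X) > 0" unfolding eq using l by (simp add: algebra_simps)
        moreover have "f p = 0" using False let_p eq bit_disj[of "?P ! j"] by simp
        ultimately show False using L0 Ht Ht0 by simp
      qed
    qed
  qed
  from X consider "X = S1" | "X = S2 a" | "X = S3 a" | "X = S4 a" | "X = S5 a b" | "X = S6 a b"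
    by (auto simp: min_square_roots_def)
  then show False
  proof cases
    case 1
    then show False using i by (simp add: S1_def)
  next
    case 2
    then show False using start_0[of "a - 1"] by (simp add: S2_def)
  next
    case 3
    then show False using start_0[of a] by (simp add: S3_def)
  next
    case 4
    then have "drop i X = replicate (Suc (a - i)) 0"
      using i by (auto simp: S4_def drop_Cons' simp flip: replicate_Suc)
    then show False using last_zeros by blast
  next
    case 5
    then have "\<alpha> > int a * \<beta>" using l0 assms(2) by fastforce
    then show False using long[of b] 5 by (simp add: S5_def)
  next
    case 6
    then have "\<alpha> > int a * \<beta>" using l0 assms(2) by fastforce
    then show False using long[of "b + 1"] 6 by (simp add: S6_def)
  qed
qed

end

section \<open>Walks with prescribed parameters and the language\<close>

lemma occurs_S4_power:
  "occurs_at f p (word_power (S4 a) n) \<longleftrightarrow> (\<forall>i<n. occurs_at f (p + i * (a + 1)) (S4 a))"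
proof (induction n arbitrary: p)
  case (Suc n)
  have "length (S4 a) = a + 1" by (simp add: S4_def)
  then have "occurs_at f p (word_power (S4 a) (Suc n)) \<longleftrightarrow>
    occurs_at f p (S4 a) \<and> (\<forall>i<n. occurs_at f (p + Suc i * (a + 1)) (S4 a))"
    using Suc.IH[of "p + (a + 1)"] by (simp add: add_ac)
  then show ?case by (auto simp: less_Suc_eq_0_disj)
qed simp

lemma S5_S4: "S5 a b = [1] @ replicate (a + 1) 0 @ word_power (S4 a) b"
  and S6_S4: "S6 a b = [1] @ replicate (a + 1) 0 @ word_power (S4 a) (b + 1)"
  by (simp_all add: S5_def S6_def S4_def)

text \<open>\<open>l\<close> is the height gained over a run \<open>1 0^a\<close>; it is positive,
  so successive short runs climb.\<close>

locale slope_walk = walk +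
  fixes a :: nat and l :: int
  assumes a: "a \<ge> 1" and \<alpha>_eq: "\<alpha> = int a * \<beta> + l" and l: "0 < l"
begin

text \<open>A 1 is read at height at least -\<beta>, so the height before the last of the
  \<open>a\<close> zeros is still at least \<open>l\<close>.\<close>

lemma short_run:
  assumes "f p = 1"
  shows "occurs_at f p (S4 a)" "H (p + (a + 1)) = H p + l"
proof -
  have "H (Suc p) - int (a - 1) * \<beta> = H p + \<beta> + l"
    using H_1[OF assms] \<alpha>_eq a by (simp add: algebra_simps of_nat_diff)
  then have "H (Suc p) - int (a - 1) * \<beta> > 0" using range[of p] l by simp
  from occurs_zeros[OF disjI2[OF this]] show "occurs_at f p (S4 a)" "H (p + (a + 1)) = H p + l"
    using assms H_1[OF assms] \<alpha>_eq by (auto simp: S4_def algebra_simps)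
qed

lemma consecutive_runs:
  "(\<And>i. i < n \<Longrightarrow> f (p + i * (a + 1)) = 1) \<Longrightarrow> H (p + n * (a + 1)) = H p + int n * l"
proof (induction n)
  case (Suc n)
  then have "H (p + n * (a + 1)) = H p + int n * l" "f (p + n * (a + 1)) = 1" by auto
  then show ?case using short_run(2)[of "p + n * (a + 1)"] by (simp add: algebra_simps)
qed simp

end

locale params_walk = slope_walk +
  fixes b :: nat and r :: int
  assumes \<beta>_eq: "\<beta> = int (b + 1) * l + r"
    and r: "0 \<le> r" "r < l"
    and zeros: "r > 0 \<or> (\<exists>c. \<forall>p. H p = 0 \<longrightarrow> f p = c)"
begin

lemma zeros_eq: "r = 0 \<Longrightarrow> H p = 0 \<Longrightarrow> H q = 0 \<Longrightarrow> f p = f q"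
  using zeros by auto

lemma \<beta>_ge: "\<beta> \<ge> l"
  using \<beta>_eq l r by (simp add: algebra_simps)

text \<open>A negative height forces a 1, and each short run adds \<open>l\<close>. At height 0 with
  \<open>r = 0\<close>, one known letter at a zero fixes the letters at all zeros.\<close>

lemma short_runs:
  assumes "\<And>i. i < n \<Longrightarrow> H p + int i * l < 0 \<or> (H p + int i * l = 0 \<and> r = 0 \<and> (\<exists>q. H q = 0 \<and> f q = 1))"
  shows "(\<forall>i<n. f (p + i * (a + 1)) = 1) \<and> H (p + n * (a + 1)) = H p + int n * l"
  using assms
proof (induction n)
  case (Suc n)
  then have IH: "\<forall>i<n. f (p + i * (a + 1)) = 1" "H (p + n * (a + 1)) = H p + int n * l" by auto
  have "f (p + n * (a + 1)) = 1"
    using Suc.prems[of n] IH(2) letter_neg zeros_eq by (metis lessI)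
  moreover from short_run(2)[OF this] have "H (p + Suc n * (a + 1)) = H p + int (Suc n) * l"
    using IH(2) by (simp add: algebra_simps)
  ultimately show ?case using IH(1) less_Suc_eq by auto
qed simp

lemma long_run:
  assumes "f p = 1" "f (p + (a + 1)) = 0"
  shows "occurs_at f p ([1] @ replicate (a + 1) 0)" "H (p + (a + 2)) = H p + l - \<beta>"
proof -
  have "replicate (a + 1) (0::bit) = replicate a 0 @ [0]"
    by (simp add: replicate_append_same)
  then have "[1] @ replicate (a + 1) 0 = S4 a @ [0]" by (simp add: S4_def)
  then show "occurs_at f p ([1] @ replicate (a + 1) 0)"
    using short_run[OF assms(1)] assms(2) by (simp add: S4_def)
  show "H (p + (a + 2)) = H p + l - \<beta>"
    using H_0[OF assms(2)] short_run(2)[OF assms(1)] by simp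
qed

text \<open>The last of the \<open>n\<close> short runs starts at height
  \<open>H p + n l - \<beta>\<close>, which the third hypothesis makes negative, or 0 in the case
  decided by \<open>zeros_eq\<close>.\<close>

lemma long_block:
  assumes "f p = 1" "f (p + (a + 1)) = 0"
    and "n = 0 \<or> H p + int n * l < \<beta> \<or> H p + int n * l = \<beta> \<and> r = 0 \<and> (\<exists>q. H q = 0 \<and> f q = 1)"
  shows "occurs_at f p ([1] @ replicate (a + 1) 0 @ word_power (S4 a) n)"
    "H (p + (a + 2) + n * (a + 1)) = H p + l - \<beta> + int n * l"
    "\<And>i. i < n \<Longrightarrow> f (p + (a + 2) + i * (a + 1)) = 1"
proof -
  note L = long_run[OF assms(1,2)]
  have *: "(\<forall>i<n. f (p + (a + 2) + i * (a + 1)) = 1) \<and>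
    H (p + (a + 2) + n * (a + 1)) = H (p + (a + 2)) + int n * l"
  proof (rule short_runs)
    fix i assume i: "i < n"
    show "H (p + (a + 2)) + int i * l < 0 \<or>
      (H (p + (a + 2)) + int i * l = 0 \<and> r = 0 \<and> (\<exists>q. H q = 0 \<and> f q = 1))"
    proof (cases "i = n - 1")
      case True
      then have "int i * l = int n * l - l" using i by (simp add: of_nat_diff algebra_simps)
      then show ?thesis using assms(3) i L(2) by auto
    next
      case False
      then have "(int i + 2) * l \<le> int n * l" using i l by (intro mult_right_mono) auto
      then show ?thesis using assms(3) i l L(2) by (auto simp: algebra_simps)
    qed
  qed
  then show "\<And>i. i < n \<Longrightarrow> f (p + (a + 2) + i * (a + 1)) = 1"
    "H (p + (a + 2) + n * (a + 1)) = H p + l - \<beta> + int n * l" using L(2) by auto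
  have "occurs_at f (p + (a + 2)) (word_power (S4 a) n)"
    unfolding occurs_S4_power using * short_run(1) by blast
  then show "occurs_at f p ([1] @ replicate (a + 1) 0 @ word_power (S4 a) n)"
    using L(1) by simp
qed

text \<open>A long run starts at \<open>p\<close>. As \<open>H p \<le> 0\<close> and
  \<open>(b + 1) l = \<beta> - r\<close>, there is room for \<open>b + 1\<close> short runs after
  it, so \<open>S6\<close> fits, and with it its prefix \<open>S5\<close>. Which of them is the
  block depends on what follows.\<close>

lemma block_start:
  assumes "f p = 1" "f (p + (a + 1)) = 0"
  shows "occurs_at f p (S5 a b)" "occurs_at f p (S6 a b)"
    "f (p + length (S5 a b)) = 1" "H (p + length (S5 a b)) = H p - r"
    "H (p + length (S6 a b)) = H p - r + l" "p + length (S6 a b) = p + length (S5 a b) + (a + 1)"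
proof -
  have h: "H p \<le> 0" using one assms by blast
  have e: "int (b + 1) * l = \<beta> - r" using \<beta>_eq by simp
  have c: "H p + int (b + 1) * l < \<beta> \<or>
     H p + int (b + 1) * l = \<beta> \<and> r = 0 \<and> (\<exists>q. H q = 0 \<and> f q = 1)"
    unfolding e using h r assms(1) by (cases "r = 0 \<and> H p = 0") auto
  note B = long_block[OF assms disjI2[OF c]]
  show 6: "occurs_at f p (S6 a b)" using B(1) by (simp add: S6_S4)
  have "S6 a b = S5 a b @ S4 a"
    using word_power_snoc[of "S4 a" b] by (simp add: S5_S4 S6_S4)
  then show "occurs_at f p (S5 a b)" using 6 by simp
  have len: "length (S5 a b) = (a + 2) + b * (a + 1)" "length (S6 a b) = (a + 2) + (b + 1) * (a + 1)"
    by (simp_all add: S5_def S6_def)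
  show f1: "f (p + length (S5 a b)) = 1" using B(3)[of b] by (simp only: len add.assoc)
  show eq: "p + length (S6 a b) = p + length (S5 a b) + (a + 1)" by (simp add: len)
  show H6: "H (p + length (S6 a b)) = H p - r + l"
    using B(2) e by (simp only: len add.assoc) 
  show "H (p + length (S5 a b)) = H p - r"
    using short_run(2)[OF f1] H6 unfolding eq by simp
qed

text \<open>If a 0 follows the copy of \<open>S6\<close>, its last run is really long and opens the
  next block, so the block is \<open>S5\<close>. Otherwise the run after \<open>S6\<close> is long:
  its first \<open>a\<close> zeros end above \<open>H p + l\<close>, which is nonnegative by the 0
  at \<open>p + (a + 1)\<close>.\<close>

lemma next_block:
  assumes "f p = 1" "f (p + (a + 1)) = 0"
  shows "\<exists>X. X \<in> {S5 a b, S6 a b} \<and> occurs_at f p X \<and> f (p + length X) = 1 \<and> f (p + length X + (a + 1)) = 0"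
proof (cases "f (p + length (S6 a b)) = 0")
  case True
  then show ?thesis using block_start[OF assms] by (intro exI[of _ "S5 a b"]) auto
next
  case False
  then have f1: "f (p + length (S6 a b)) = 1" by (simp add: bit_not_zero_iff)
  have "H p + l \<ge> 0" using zero[OF assms(2)] short_run[OF assms(1)] by simp
  then have "H (p + length (S6 a b) + (a + 1)) > 0"
    using short_run(2)[OF f1] block_start(5)[OF assms] r by simp
  then have "f (p + length (S6 a b) + (a + 1)) = 0" by (rule letter_pos)
  then show ?thesis using f1 block_start(2)[OF assms] by blast
qed

text \<open>Short runs climb by \<open>l\<close> but start only at heights at most 0, so a long run
  must come.\<close>

lemma block_exists: "\<exists>q. f q = 1 \<and> f (q + (a + 1)) = 0"
proof -
  have "\<exists>q. f q = 1 \<and> f (q + (a + 1)) = 0" if "f p = 1" for p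
    using that
  proof (induction "nat (- H p)" arbitrary: p rule: less_induct)
    case (less p)
    show ?case
    proof (cases "f (p + (a + 1)) = 0")
      case False
      then have f1: "f (p + (a + 1)) = 1" by (simp add: bit_not_zero_iff)
      then have "nat (- H (p + (a + 1))) < nat (- H p)"
        using short_run(2)[OF less.prems] one[OF f1] l by simp
      then show ?thesis using less f1 by blast
    qed (use less in blast)
  qed
  moreover have "\<exists>p. f p = 1"
  proof (cases "f 0 = 0")
    case True
    then have "H 1 < 0" using pos by simp
    then show ?thesis using letter_neg by blast
  qed (auto simp: bit_not_zero_iff)
  ultimately show ?thesis by blast
qed

lemma lang_occurs:
  assumes per: "\<And>p. f (p + N) = f p" and "N > 0" and z: "occurs_at f p z"
  shows "z \<in> lang a b"
proof -
  define P where "P p \<longleftrightarrow> f p = 1 \<and> f (p + (a + 1)) = 0" for p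
  define X where "X p = (SOME X. X \<in> {S5 a b, S6 a b} \<and> occurs_at f p X \<and> P (p + length X))" for p
  have X: "X p \<in> {S5 a b, S6 a b}" "occurs_at f p (X p)" "P (p + length (X p))" if "P p" for p
    using someI_ex[OF next_block[of p, folded P_def], folded X_def] that unfolding P_def by blast+
  define nx where "nx p = p + length (X p)" for p
  obtain q where q: "P q" using block_exists P_def by blast
  have snth: "flat (smap X (siterate nx p)) !! i = f (p + i)" if "P p" for p i
    using that
  proof (induction i arbitrary: p rule: less_induct)
    case (less i)
    have ne: "X p \<noteq> []" using X(1)[OF less.prems] by (auto simp: S5_def S6_def)
    then have flat: "flat (smap X (siterate nx p)) = X p @- flat (smap X (siterate nx (nx p)))"
      using flat_unfold[of "smap X (siterate nx p)"] by simp
    show ?case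
    proof (cases "i < length (X p)")
      case True
      then show ?thesis using X(2)[OF less.prems] by (simp add: flat occurs_at_iff)
    next
      case False
      have "P (nx p)" using X(3)[OF less.prems] by (simp add: nx_def)
      moreover have "i - length (X p) < i" using False ne by (cases "X p") auto
      ultimately have "flat (smap X (siterate nx (nx p))) !! (i - length (X p)) = f (nx p + (i - length (X p)))"
        by (rule less.IH[rotated])
      moreover have "nx p + (i - length (X p)) = p + i" using False by (simp add: nx_def)
      ultimately show ?thesis using False by (simp add: flat)
    qed
  qed
  have sset: "sset (smap X (siterate nx q)) \<subseteq> {S5 a b, S6 a b}"
  proof -
    have "P ((nx ^^ n) q)" for n by (induction n) (auto simp: q X(3) nx_def)
    then show ?thesis using X(1) by (auto simp: sset_siterate stream.set_map)
  qed
  have perk: "f (i + k * N) = f i" for i k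
    by (induction k) (auto simp: per add.assoc[symmetric] add.commute[of N])
  \<comment> \<open>Adding \<open>q\<close> periods moves the occurrence behind \<open>q\<close>,
    where the concatenation of blocks begins.\<close>
  define k where "k = p + q * N - q"
  have "q \<le> q * N" using assms(2) by simp
  then have "p + q * N = q + k" unfolding k_def by linarith
  then have "z = stake (length z) (sdrop k (flat (smap X (siterate nx q))))"
    using z perk[of "p + _" q]
    by (intro nth_equalityI) (auto simp: sdrop_snth snth[OF q] occurs_at_iff add_ac)
  then show ?thesis unfolding lang_def using sset by blast
qed

lemma S3_S4: "S3 a = 0 # S4 a"
  by (simp add: S3_def S4_def)

lemma S2_S4: "S2 a = take (a + 1) (0 # S4 a)" and length_S2: "length (S2 a) = a + 1"
  using a by (simp_all add: S2_def S4_def min_def take_Cons')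

lemma length_S4: "length (S4 a) = a + 1"
  by (simp add: S4_def)

text \<open>The letters from \<open>2 * t\<close> on select the root. As \<open>H t\<close> is half
  of \<open>H (2 * t)\<close>, the walk at \<open>t\<close> is then forced to read the same root;
  \<open>start\<close> settles the case where the sign gives no information.\<close>

lemma next_double_step:
  assumes even: "H (2 * t) = 2 * H t" and start: "H t = 0 \<Longrightarrow> f (2 * t) = f t"
  shows "\<exists>X. X \<in> min_square_roots a b \<and> occurs_at f t X \<and> occurs_at f (2 * t) X \<and> occurs_at f (2 * t + length X) X"
proof (cases "f (2 * t) = 0")
  case True
  have h: "H t \<ge> 0" using zero[OF True] even by simp
  have t: "f t = 0"
    using h start True letter_pos by (cases "H t = 0") auto
  show ?thesis
  proof (cases "f (2 * t + 1) = 0")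
    case z: True
    show ?thesis using True t z by (intro exI[of _ S1]) (auto simp: S1_def min_square_roots_def)
  next
    case False
    then have f1: "f (2 * t + 1) = 1" by (simp add: bit_not_zero_iff)
    have H1: "H (2 * t + 1) = 2 * H t - \<beta>" using H_0[OF True] even by simp
    then have h2: "2 * H t \<le> \<beta>" using one[OF f1] by simp
    have "H (t + 1) < 0" using H_0[OF t] h h2 pos by auto
    then have g1: "f (t + 1) = 1" by (rule letter_neg)
    have o2: "occurs_at f (2 * t) (0 # S4 a)" and o1: "occurs_at f t (0 # S4 a)"
      using True t short_run(1)[OF f1] short_run(1)[OF g1] by auto
    have last: "f (2 * t + (a + 1)) = 0"
      using short_run(1)[OF f1] a by (auto simp: S4_def occurs_at_iff nth_Cons' dest: spec[of _ a])
    have next_H: "H (2 * t + (a + 1) + 1) = 2 * H t - \<beta> + l"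
      using short_run(2)[OF f1] H1 by (simp add: add_ac)
    show ?thesis
    proof (cases "f (2 * t + (a + 1) + 1) = 1")
      case n: True
      \<comment> \<open>The root is \<open>S2\<close>: its second copy begins with the last zero of
        the run \<open>1 0^a\<close>.\<close>
      have o3: "occurs_at f (2 * t + (a + 1)) (0 # S4 a)"
        using last short_run(1)[OF n] by simp
      show ?thesis
        using occurs_at_take[OF o1, of "a + 1"] occurs_at_take[OF o2, of "a + 1"] occurs_at_take[OF o3, of "a + 1"]
        by (intro exI[of _ "S2 a"]) (simp only: S2_S4[symmetric] length_S2, auto simp: min_square_roots_def)
    next
      case False
      then have n: "f (2 * t + (a + 2)) = 0" by (simp add: bit_not_one_iff)
      have n2: "H (2 * t + (a + 2) + 1) = 2 * H t - \<beta> + l - \<beta>"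
        using H_0[OF n] next_H by simp
      \<comment> \<open>The height here is \<open>2 * H t - 2 \<beta> + l\<close>, at most 0 by
        \<open>2 * H t \<le> \<beta>\<close> and \<open>l \<le> \<beta>\<close>. Equality forces
        \<open>r = 0\<close>, and then this zero carries the same letter as the one at
        \<open>2 * t + 1\<close>.\<close>
      have "f (2 * t + (a + 2) + 1) = 1"
      proof (cases "H (2 * t + (a + 2) + 1) < 0")
        case True
        then show ?thesis by (rule letter_neg)
      next
        case False
        then have "\<beta> = l" "2 * H t = \<beta>" using n2 h2 \<beta>_ge by auto
        moreover from this have "r = 0" using \<beta>_eq r l by (simp add: algebra_simps) (smt (verit) mult_nonneg_nonneg of_nat_0_le_iff)
        ultimately show ?thesis using zeros_eq[of "2 * t + 1" "2 * t + (a + 2) + 1"] f1 H1 n2 by simp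
      qed
      then have "occurs_at f (2 * t + (a + 2)) (0 # S4 a)" using n short_run(1) by simp
      then show ?thesis using o1 o2
        by (intro exI[of _ "S3 a"]) (auto simp: S3_S4 length_S4 min_square_roots_def)
    qed
  qed
next
  case False
  then have f2: "f (2 * t) = 1" by (simp add: bit_not_zero_iff)
  have h: "H t \<le> 0" using one[OF f2] even by simp
  have t: "f t = 1"
    using h start f2 letter_neg by (cases "H t = 0") auto
  show ?thesis
  proof (cases "f (2 * t + (a + 1)) = 1")
    case True
    show ?thesis using short_run(1)[OF True] short_run(1)[OF f2] short_run(1)[OF t]
      by (intro exI[of _ "S4 a"]) (auto simp: length_S4 min_square_roots_def)
  next
    case False
    then have n: "f (2 * t + (a + 1)) = 0" by (simp add: bit_not_one_iff)
    \<comment> \<open>The long run at \<open>2 * t\<close> requires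
      \<open>2 * H t + l \<ge> 0\<close>, whence \<open>H t + l > 0\<close> and the run at
      \<open>t\<close> is long as well.\<close>
    have hl: "2 * H t + l \<ge> 0" using zero[OF n] short_run(2)[OF f2] even by simp
    then have "H (t + (a + 1)) > 0" using short_run(2)[OF t] l by simp
    then have g: "f (t + (a + 1)) = 0" by (rule letter_pos)
    note B2 = block_start[OF f2 n] and B1 = block_start[OF t g]
    let ?Q = "2 * t + length (S6 a b)"
    show ?thesis
    \<comment> \<open>As in \<open>next_block\<close>, this letter decides whether the block at
      \<open>2 * t\<close> is \<open>S5\<close> or \<open>S6\<close>; at \<open>t\<close> both
      occur.\<close>
    proof (cases "f ?Q = 0")
      case True
      have "f (2 * t + length (S5 a b) + (a + 1)) = 0" using True B2(6) by simp
      then show ?thesis using B1(1) B2(1) block_start(1)[OF B2(3)]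
        by (intro exI[of _ "S5 a b"]) (auto simp: min_square_roots_def)
    next
      case False
      then have q: "f ?Q = 1" by (simp add: bit_not_zero_iff)
      have "H (?Q + (a + 1)) > 0" using short_run(2)[OF q] B2(5) even hl r by simp
      then have "f (?Q + (a + 1)) = 0" by (rule letter_pos)
      then show ?thesis using B1(2) B2(2) block_start(2)[OF q]
        by (intro exI[of _ "S6 a b"]) (auto simp: min_square_roots_def)
    qed
  qed
qed

end

text \<open>A local form of being an infinite concatenation, which spares an indexing of the blocks:
  the long run after each block witnesses that another block begins there.\<close>

definition block_sequence :: "nat \<Rightarrow> nat \<Rightarrow> (nat \<Rightarrow> bit) \<Rightarrow> bool" where
  "block_sequence a b F \<longleftrightarrow> (\<forall>p. \<exists>s X. s \<le> p \<and> p < s + length X \<and> X \<in> {S5 a b, S6 a b} \<and>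
     occurs_at F s X \<and> occurs_at F (s + length X) ([1] @ replicate (a + 1) 0))"

lemma occurs_at_shift: "occurs_at (\<lambda>i. F (k + i)) s X \<longleftrightarrow> occurs_at F (k + s) X"
  by (simp add: occurs_at_iff add.assoc)

lemma block_sequence_flat:
  assumes "sset Xs \<subseteq> {S5 a b, S6 a b}"
  shows "block_sequence a b (\<lambda>i. flat Xs !! i)"
  unfolding block_sequence_def
proof
  fix p
  show "\<exists>s X. s \<le> p \<and> p < s + length X \<and> X \<in> {S5 a b, S6 a b} \<and>
     occurs_at (\<lambda>i. flat Xs !! i) s X \<and> occurs_at (\<lambda>i. flat Xs !! i) (s + length X) ([1] @ replicate (a + 1) 0)"
    using assms
  proof (induction p arbitrary: Xs rule: less_induct)
    case (less p)
    have ne: "X \<noteq> []" if "X \<in> {S5 a b, S6 a b}" for X using that by (auto simp: S5_def S6_def)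
    obtain X Y Zs where Xs: "Xs = X ## Y ## Zs" by (metis stream.collapse)
    have XY: "X \<in> {S5 a b, S6 a b}" "Y \<in> {S5 a b, S6 a b}" using less.prems Xs by auto
    have fl: "flat Xs = X @- flat (Y ## Zs)" "flat (Y ## Zs) = Y @- flat Zs"
      using XY ne by (simp_all add: Xs)
    have shift: "(\<lambda>i. flat (Y ## Zs) !! i) = (\<lambda>i. flat Xs !! (length X + i))"
      by (simp add: fl(1))
    show ?case
    proof (cases "p < length X")
      case True
      have "occurs_at (\<lambda>i. flat Xs !! i) 0 X" by (simp add: fl(1) occurs_at_iff)
      moreover have "occurs_at (\<lambda>i. flat (Y ## Zs) !! i) 0 Y"
        unfolding fl(2) by (simp add: occurs_at_iff)
      then have "occurs_at (\<lambda>i. flat Xs !! i) (length X) Y"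
        unfolding shift occurs_at_shift by simp
      then have "occurs_at (\<lambda>i. flat Xs !! i) (length X) ([1] @ replicate (a + 1) 0)"
        using XY(2) by (auto simp: S5_def S6_def)
      ultimately show ?thesis using True XY(1) by (intro exI[of _ 0] exI[of _ X]) auto
    next
      case False
      have "p - length X < p" using False ne[OF XY(1)] by (cases X) auto
      moreover have "sset (Y ## Zs) \<subseteq> {S5 a b, S6 a b}" using less.prems Xs by auto
      ultimately obtain s Z where s: "s \<le> p - length X" "p - length X < s + length Z" "Z \<in> {S5 a b, S6 a b}"
        "occurs_at (\<lambda>i. flat (Y ## Zs) !! i) s Z"
        "occurs_at (\<lambda>i. flat (Y ## Zs) !! i) (s + length Z) ([1] @ replicate (a + 1) 0)"
        using less.IH by blast
      then show ?thesis using False unfolding shift occurs_at_shift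
        by (intro exI[of _ "length X + s"] exI[of _ Z]) (auto simp: add.assoc)
    qed
  qed
qed

lemma lang_block_sequence:
  assumes "z \<in> lang a b"
  shows "\<exists>F q. block_sequence a b F \<and> (\<forall>i<length z. F (q + i) = z ! i)"
proof -
  obtain n m Xs where z: "z = stake n (sdrop m (flat Xs))" "sset Xs \<subseteq> {S5 a b, S6 a b}"
    using assms by (auto simp: lang_def)
  then show ?thesis using block_sequence_flat[OF z(2)]
    by (intro exI[of _ "\<lambda>i. flat Xs !! i"] exI[of _ m]) (auto simp: sdrop_snth)
qed

text \<open>A 1 occurs only at the start of a block or of one of its \<open>b\<close> or
  \<open>b + 1\<close> short runs. So at least \<open>b\<close> short runs follow a long one, and
  among \<open>b + 2\<close> consecutive runs one is long. A run is long when a 0 stands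
  \<open>a + 1\<close> places after its 1.\<close>

lemma block_sequence_runs:
  assumes "block_sequence a b F" "F p = 1"
  shows "\<And>i. 1 \<le> i \<Longrightarrow> i \<le> a \<Longrightarrow> F (p + i) = 0"
    "\<And>e. F (p + (a + 1)) = 0 \<Longrightarrow> e \<le> b \<Longrightarrow> F (p + (a + 2) + e * (a + 1)) = 1"
    "\<exists>e\<ge>1. e \<le> b + 2 \<and> F (p + e * (a + 1)) = 0"
proof -
  obtain s X where s: "s \<le> p" "p < s + length X" "X \<in> {S5 a b, S6 a b}" "occurs_at F s X"
    "occurs_at F (s + length X) ([1] @ replicate (a + 1) 0)"
    using assms(1) unfolding block_sequence_def by blast
  then obtain c where c: "c = b \<or> c = b + 1" "X = [1] @ replicate (a + 1) 0 @ word_power (S4 a) c"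
    using S5_S4 S6_S4 by blast
  have len: "length X = (a + 2) + c * (a + 1)" by (simp add: c(2) S4_def)
  have st: "occurs_at F s ([1] @ replicate (a + 1) 0)" using s(4) c(2) by simp
  have pw: "occurs_at F (s + (a + 2) + e * (a + 1)) (S4 a)" if "e < c" for e
    using s(4) c(2) that occurs_S4_power[of F "s + (a + 2)" a c] by simp
  have en: "occurs_at F (s + (a + 2) + c * (a + 1)) ([1] @ replicate (a + 1) 0)"
    using s(5) by (simp only: len add.assoc)
  have z: "F (u + i) = 0" if "occurs_at F u ([1] @ replicate k 0)" "1 \<le> i" "i \<le> k" for u i k
    using that by (auto simp: occurs_at_iff nth_Cons' dest: spec[of _ i])
  have o: "F (s + (a + 2) + e * (a + 1)) = 1" if "e \<le> c" for e
    using pw[of e] en that by (cases "e = c") (auto simp: S4_def)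
  show "\<exists>e\<ge>1. e \<le> b + 2 \<and> F (p + e * (a + 1)) = 0"
    "\<And>i. 1 \<le> i \<Longrightarrow> i \<le> a \<Longrightarrow> F (p + i) = 0"
    "\<And>e. F (p + (a + 1)) = 0 \<Longrightarrow> e \<le> b \<Longrightarrow> F (p + (a + 2) + e * (a + 1)) = 1"
  proof -
    consider "p = s" | e where "e < c" "p = s + (a + 2) + e * (a + 1)"
    proof (cases "p < s + (a + 2)")
      case True
      have "p = s"
      proof (rule ccontr)
        assume "p \<noteq> s"
        then have "F (s + (p - s)) = 0" using True s(1) by (intro z[OF st]) linarith+
        then show False using assms(2) s(1) by simp
      qed
      then show ?thesis using that by blast
    next
      case False
      \<comment> \<open>The offset behind the long run is divided by the length \<open>a + 1\<close>
        of a short run; the remainder vanishes because \<open>F p = 1\<close>.\<close>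
      define d where "d = p - (s + (a + 2))"
      define e where "e = d div (a + 1)"
      define i where "i = d mod (a + 1)"
      have "d = e * (a + 1) + i" unfolding e_def i_def by (rule div_mult_mod_eq[symmetric])
      then have p: "p = s + (a + 2) + e * (a + 1) + i"
        using False unfolding d_def by linarith
      have "d < c * (a + 1)" using s(2) len False by (simp add: d_def)
      then have e: "e < c" unfolding e_def by (rule less_mult_imp_div_less)
      have "i \<le> a" unfolding i_def by (metis Suc_eq_plus1 less_Suc_eq_le mod_less_divisor zero_less_Suc)
      then have "i = 0" using z[OF pw[OF e, unfolded S4_def], of i] assms(2) p by (cases "i = 0") auto
      then show ?thesis using that e p by simp
    qed
    then have "(\<exists>e\<ge>1. e \<le> b + 2 \<and> F (p + e * (a + 1)) = 0) \<and>
      (\<forall>i. 1 \<le> i \<longrightarrow> i \<le> a \<longrightarrow> F (p + i) = 0) \<and>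
      (\<forall>e. F (p + (a + 1)) = 0 \<longrightarrow> e \<le> b \<longrightarrow> F (p + (a + 2) + e * (a + 1)) = 1)"
    proof cases
      case 1
      have "F (p + 1 * (a + 1)) = 0" using z[OF st, of "a + 1"] 1 by simp
      then have "\<exists>e\<ge>1. e \<le> b + 2 \<and> F (p + e * (a + 1)) = 0" by (intro exI[of _ 1]) simp
      then show ?thesis using z[OF st] o 1 c(1) by auto
    next
      case 2
      have "F (p + (a + 1)) = 1" using o[of "Suc e"] 2 by (simp add: add_ac)
      \<comment> \<open>From the short run of index \<open>e\<close> on, \<open>c - e\<close> short
        runs remain, and then the next block opens with a long run.\<close>
      moreover have "F (p + (c - e + 1) * (a + 1)) = 0"
      proof -
        have "e * (a + 1) + (c - e + 1) * (a + 1) = c * (a + 1) + (a + 1)"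
          using 2(1) by (simp flip: add_mult_distrib)
        then have eq: "p + (c - e + 1) * (a + 1) = s + (a + 2) + c * (a + 1) + (a + 1)"
          using 2(2) by linarith
        show ?thesis unfolding eq using z[OF en, of "a + 1"] by simp
      qed
      then have "\<exists>e\<ge>1. e \<le> b + 2 \<and> F (p + e * (a + 1)) = 0"
        using c(1) 2(1) by (intro exI[of _ "c - e + 1"]) auto
      ultimately show ?thesis using z[OF pw[OF 2(1), unfolded S4_def]] 2(2) by auto
    qed
    then show "\<exists>e\<ge>1. e \<le> b + 2 \<and> F (p + e * (a + 1)) = 0"
      "\<And>i. 1 \<le> i \<Longrightarrow> i \<le> a \<Longrightarrow> F (p + i) = 0"
      "\<And>e. F (p + (a + 1)) = 0 \<Longrightarrow> e \<le> b \<Longrightarrow> F (p + (a + 2) + e * (a + 1)) = 1"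
      by blast+
  qed
qed

section \<open>The block structure of solutions\<close>

lemma length_concat_squares: "length (concat_squares Xs) = 2 * length (concat Xs)"
  by (induction Xs) (auto simp: concat_squares_def)

lemma concat_squares_simps [simp]:
  "concat_squares [] = []" "concat_squares (X # Xs) = X @ X @ concat_squares Xs"
  "concat_squares (Xs @ Ys) = concat_squares Xs @ concat_squares Ys"
  by (simp_all add: concat_squares_def)

lemma height_concat_squares: "height \<alpha> \<beta> (concat_squares Xs) = 2 * height \<alpha> \<beta> (concat Xs)"
  by (induction Xs) auto

lemma occurs_at_periodic_square: "occurs_at (periodic w) 0 (w @ w)"
  using occurs_at_periodic[of w 0] occurs_at_periodic[of w 1] by simp

lemma concat_position:
  "p < length (concat Xs) \<Longrightarrow>
     \<exists>Ys X Zs. Xs = Ys @ X # Zs \<and> length (concat Ys) \<le> p \<and> p < length (concat Ys) + length X"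
proof (induction Xs arbitrary: p)
  case (Cons X Xs)
  show ?case
  proof (cases "p < length X")
    case True
    then show ?thesis by (intro exI[of _ "[]"] exI[of _ X] exI[of _ Xs]) auto
  next
    case False
    then have "p - length X < length (concat Xs)" using Cons.prems by auto
    then obtain Ys Y Zs where "Xs = Ys @ Y # Zs" "length (concat Ys) \<le> p - length X"
      "p - length X < length (concat Ys) + length Y"
      using Cons.IH by blast
    then show ?thesis using False by (intro exI[of _ "X # Ys"] exI[of _ Y] exI[of _ Zs]) auto
  qed
qed simp

text \<open>Squaring doubles the length and the height of the preceding factors, so the square of
  \<open>X\<close> stands at twice the position of \<open>X\<close>.\<close>

lemma concat_double_step:
  assumes "set Xs \<subseteq> min_square_roots a b" "w = concat Xs" "concat_squares Xs = w @ w" "Xs = Ys @ X # Zs"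
  shows "double_step a b (periodic w) \<alpha> \<beta> (length (concat Ys)) X"
proof -
  have "occurs_at (periodic w) 0 (concat Ys @ X @ concat Zs)"
    using occurs_at_periodic0[of w] assms(2,4) by simp
  moreover have sq: "occurs_at (periodic w) 0 (concat_squares Ys @ X @ X @ concat_squares Zs)"
    using occurs_at_periodic_square[of w] unfolding assms(3)[symmetric] assms(4) by simp
  moreover have "prefix_height (periodic w) \<alpha> \<beta> (2 * length (concat Ys)) =
    2 * prefix_height (periodic w) \<alpha> \<beta> (length (concat Ys))"
    using prefix_height_occurs[of "periodic w" 0 "concat Ys" \<alpha> \<beta>]
      prefix_height_occurs[of "periodic w" 0 "concat_squares Ys" \<alpha> \<beta>] calculation
    by (simp add: length_concat_squares height_concat_squares)
  ultimately show ?thesis using assms(1,4)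
    by (auto simp: double_step_def length_concat_squares)
qed

text \<open>For slope \<open>(a, 1)\<close> the height compares zeros with \<open>a\<close> times
  the ones. Summed over the factors this gives \<alpha> \<ge> a\<beta>; strictness excludes
  \<open>S5\<close> and \<open>S6\<close> in case of equality.\<close>

lemma height_root_nonpos:
  assumes "a \<ge> 1" "X \<in> min_square_roots a b"
  shows "height (int a) 1 X \<le> 0 \<and> (X = S5 a b \<or> X = S6 a b \<longrightarrow> height (int a) 1 X < 0)"
  using assms by (auto simp: min_square_roots_def height_min_square_roots)

lemma height_concat_nonpos:
  "a \<ge> 1 \<Longrightarrow> set Xs \<subseteq> min_square_roots a b \<Longrightarrow> height (int a) 1 (concat Xs) \<le> 0"
  using height_root_nonpos by (induction Xs) force+

text \<open>Collects what a solution yields. The last conclusion cuts its decomposition at an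
  arbitrary zero, which is possible as no factor has a zero inside; nonprimitive solutions are
  treated by it.\<close>

lemma solution_walk:
  assumes a: "a \<ge> 1" and sol: "solution a b w" and "1 \<in> set w"
  obtains \<alpha> \<beta> g :: nat where "coprime \<alpha> \<beta>" "\<beta> \<ge> 1" "\<alpha> \<ge> a * \<beta>" "g \<ge> 1"
    "count_list w 0 = g * \<alpha>" "count_list w 1 = g * \<beta>"
    "walk (periodic w) (int \<alpha>) (int \<beta>)"
    "\<And>p. p < length w \<Longrightarrow> prefix_height (periodic w) (int \<alpha>) (int \<beta>) p = 0 \<Longrightarrow> periodic w (2 * p) = periodic w p"
    "\<And>p. p < length w \<Longrightarrow> prefix_height (periodic w) (int \<alpha>) (int \<beta>) p = 0 \<Longrightarrow>
      \<exists>Ys. set Ys \<subseteq> min_square_roots a b \<and> occurs_at (periodic w) 0 (concat Ys) \<and>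
        occurs_at (periodic w) 0 (concat_squares Ys) \<and> length (concat Ys) = p"
proof -
  obtain Xs where Xs: "set Xs \<subseteq> min_square_roots a b" "w = concat Xs" "concat_squares Xs = w @ w"
    using sol by (auto simp: solution_def)
  let ?A = "count_list w 0" and ?B = "count_list w 1"
  have B: "?B \<ge> 1" using assms(3) by (simp add: Suc_le_eq count_list_0_iff flip: neq0_conv)
  have "int a * int ?B - int ?A \<le> 0"
    using height_concat_nonpos[OF a Xs(1)] by (simp add: height_def Xs(2))
  then have AB: "?A \<ge> a * ?B" by (simp flip: of_nat_mult)
  define g where "g = gcd ?A ?B"
  define \<alpha> where "\<alpha> = ?A div g"
  define \<beta> where "\<beta> = ?B div g"
  have g: "g \<ge> 1" using B by (simp add: g_def Suc_le_eq)
  have A_eq: "?A = g * \<alpha>" and B_eq: "?B = g * \<beta>" by (simp_all add: \<alpha>_def \<beta>_def g_def)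
  have cop: "coprime \<alpha> \<beta>" unfolding \<alpha>_def \<beta>_def g_def using B by (intro div_gcd_coprime) auto
  have \<beta>: "\<beta> \<ge> 1" using B B_eq by (cases \<beta>) auto
  have "g * \<alpha> \<ge> g * (a * \<beta>)" using AB unfolding A_eq B_eq by (simp add: mult_ac)
  then have \<alpha>\<beta>: "\<alpha> \<ge> a * \<beta>" using g by simp
  have "a * \<beta> \<ge> 1" using a \<beta> by simp
  then have \<alpha>: "\<alpha> \<ge> 1" using \<alpha>\<beta> by linarith
  let ?H = "prefix_height (periodic w) (int \<alpha>) (int \<beta>)"
  have h0: "height (int \<alpha>) (int \<beta>) w = 0" unfolding height_def A_eq B_eq by simp
  have \<alpha>\<beta>': "int \<alpha> \<ge> int a * int \<beta>" using \<alpha>\<beta> by (simp flip: of_nat_mult)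
  have walk: "walk (periodic w) (int \<alpha>) (int \<beta>)"
  proof (rule walk_from_double_steps[OF a])
    show "0 < length w" using assms(3) by auto
    show "\<exists>t X. double_step a b (periodic w) (int \<alpha>) (int \<beta>) t X \<and> t \<le> p \<and> p < t + length X"
      if "p < length w" for p
      using concat_position[of p Xs] that concat_double_step[OF Xs] Xs(2) by blast
  qed (use \<alpha> \<beta> \<alpha>\<beta>' prefix_height_periodic[OF h0] in auto)
  have main: "\<exists>Ys X Zs. Xs = Ys @ X # Zs \<and> length (concat Ys) = p"
    "periodic w (2 * p) = periodic w p"
    if p: "p < length w" "?H p = 0" for p
  proof -
    obtain Ys X Zs where Ys: "Xs = Ys @ X # Zs" "length (concat Ys) \<le> p" "p < length (concat Ys) + length X"
      using concat_position[of p Xs] p Xs(2) by blast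
    note step = concat_double_step[OF Xs Ys(1), of "int \<alpha>" "int \<beta>"]
    \<comment> \<open>All factors have nonpositive height for slope \<open>(a, 1)\<close>, and here
      these heights add up to 0, so none is negative.\<close>
    have no56: "X \<noteq> S5 a b \<and> X \<noteq> S6 a b" if eq: "int \<alpha> = int a * int \<beta>"
    proof -
      have "\<alpha> = a * \<beta>" using eq by (simp flip: of_nat_mult)
      then have "int a * int ?B - int ?A = 0" unfolding A_eq B_eq by simp
      then have "height (int a) 1 (concat Ys) + height (int a) 1 X + height (int a) 1 (concat Zs) = 0"
        using Xs(2) Ys(1) by (simp add: height_def algebra_simps)
      moreover have "height (int a) 1 (concat Ys) \<le> 0" "height (int a) 1 (concat Zs) \<le> 0"
        using height_concat_nonpos[OF a] Xs(1) Ys(1) by auto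
      moreover have "X \<in> min_square_roots a b" using Xs(1) Ys(1) by auto
      ultimately show ?thesis using height_root_nonpos[OF a, of X b] by auto
    qed
    have t: "length (concat Ys) = p"
      using walk.no_interior_zero[OF walk a \<alpha>\<beta>' step _ Ys(3) no56] Ys(2) p(2) by force
    then show "\<exists>Ys X Zs. Xs = Ys @ X # Zs \<and> length (concat Ys) = p" using Ys(1) by blast
    show "periodic w (2 * p) = periodic w p"
      using double_step_letter(1)[OF step Ys(2,3)] t by (simp add: mult_2)
  qed
  have "\<exists>Ys. set Ys \<subseteq> min_square_roots a b \<and> occurs_at (periodic w) 0 (concat Ys) \<and>
        occurs_at (periodic w) 0 (concat_squares Ys) \<and> length (concat Ys) = p"
    if p: "p < length w" "?H p = 0" for p
  proof -
    obtain Ys X Zs where Ys: "Xs = Ys @ X # Zs" "length (concat Ys) = p" using main(1)[OF p] by blast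
    have "occurs_at (periodic w) 0 (concat Ys)"
      using occurs_at_periodic0[of w] unfolding Xs(2) Ys(1) by (simp add: Xs(2) Ys(1))
    moreover have "occurs_at (periodic w) 0 (concat_squares Ys)"
      using occurs_at_periodic_square[of w] unfolding Xs(3)[symmetric] Ys(1) by simp
    ultimately show ?thesis using Ys Xs(1) by auto
  qed
  then show ?thesis using that[OF cop \<beta> \<alpha>\<beta> g A_eq B_eq walk] main(2) by blast
qed

section \<open>Blocks between consecutive zeros\<close>

lemma exchange_first_two_walk:
  assumes "walk_word \<alpha> \<beta> 0 S" "\<alpha> > 0" "\<beta> > 0" "length S \<ge> 2"
  obtains x y rest where "S = x # y # rest" "x \<noteq> y" "exchange_first_two S = y # x # rest"
    "walk_word \<alpha> \<beta> 0 (y # x # rest)"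
proof -
  obtain x y rest where S: "S = x # y # rest" using assms(4) by (metis Suc_le_length_iff numeral_2_eq_2)
  \<comment> \<open>After one letter from height 0 the opposite letter is forced. Both orders lead
    to \<alpha> - \<beta>, so the rest is unaffected.\<close>
  have "x \<noteq> y" using assms(1-3) by (auto simp: S split: if_splits)
  moreover from this have "walk_word \<alpha> \<beta> 0 (y # x # rest)"
    using assms(1-3) bit_disj[of x] bit_disj[of y] by (auto simp: S algebra_simps split: if_splits)
  ultimately show ?thesis using that S by simp
qed

context coprime_walk
begin

text \<open>The word has length \<alpha> + \<beta>, the distance between consecutive zeros, so its
  first letter determines it by \<open>walk_deterministic\<close>.\<close>

lemma occurs_walk_word:
  assumes "walk_word \<alpha> \<beta> 0 v" "int (count_list v 0) = \<alpha>" "int (count_list v 1) = \<beta>" "f p = hd v" "H p = 0"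
  shows "occurs_at f p v"
proof -
  have h: "height \<alpha> \<beta> v = 0" using assms(2,3) by (simp add: height_def)
  have ne: "v \<noteq> []" using assms(2) pos by auto
  interpret V: coprime_walk "periodic v" \<alpha> \<beta>
    using walk_periodic[OF assms(1) h ne pos] coprime by (simp add: coprime_walk_def coprime_walk_axioms_def)
  have len: "int (length v) = \<alpha> + \<beta>" using assms(2,3) length_bit_word[of v] by simp
  have "f (p + i) = periodic v (0 + i)" if "i < length v" for i
  proof -
    have "V.H (0 + j) \<noteq> 0" if "0 < j" "j < length v" for j
      using V.height_zero_iff[of j] len that by (simp flip: of_nat_add) (metis int_dvd_int_iff nat_dvd_not_less)
    moreover have "f p = periodic v 0" using assms(4) ne by (simp add: periodic_def hd_conv_nth)
    ultimately show ?thesis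
      using walk_deterministic[OF walk_axioms V.walk_axioms, of p 0 "length v" i] assms(5) that by simp
  qed
  then show ?thesis by (auto simp: occurs_at_iff periodic_def)
qed

text \<open>The zeros are the multiples of \<open>length S\<close>, and the letter at a zero decides
  between the two blocks.\<close>

lemma occurs_substitute_pattern:
  assumes "walk_word \<alpha> \<beta> 0 S" "int (count_list S 0) = \<alpha>" "int (count_list S 1) = \<beta>"
  shows "occurs_at f (k * length S)
    (substitute_pattern S (map (\<lambda>j. if f (j * length S) = hd S then Letter_S else Letter_L) [k..<k + n]))"
proof (induction n)
  case 0
  show ?case by (simp add: substitute_pattern_def)
next
  case (Suc n)
  let ?m = "length S"
  let ?U = "\<lambda>j. if f (j * ?m) = hd S then Letter_S else Letter_L"
  have m: "int ?m = \<alpha> + \<beta>" using assms(2,3) length_bit_word[of S] by simp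
  then have "length S \<ge> 2" using pos by linarith
  from exchange_first_two_walk[OF assms(1) pos this]
  obtain x y rest where S: "S = x # y # rest" "x \<noteq> y" "exchange_first_two S = y # x # rest"
    "walk_word \<alpha> \<beta> 0 (y # x # rest)" by metis
  have z: "H (j * ?m) = 0" for j using height_zero_iff[of "j * ?m"] m by simp
  have block: "occurs_at f (j * ?m) (if f (j * ?m) = hd S then S else exchange_first_two S)" for j
  proof (cases "f (j * ?m) = hd S")
    case True
    then show ?thesis using occurs_walk_word[OF assms _ z] by simp
  next
    case False
    then have "f (j * ?m) = hd (y # x # rest)"
      using S(1,2) bit_disj[of x] bit_disj[of y] bit_disj[of "f (j * ?m)"] by auto
    moreover have "count_list (y # x # rest) 0 = count_list S 0" "count_list (y # x # rest) 1 = count_list S 1"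
      by (simp_all add: S(1))
    ultimately have "occurs_at f (j * ?m) (y # x # rest)"
      using occurs_walk_word[OF S(4) _ _ _ z] assms(2,3) by metis
    then show ?thesis using False S(3) by simp
  qed
  have lenP: "length (substitute_pattern S u) = length u * ?m" for u
    by (induction u) (auto simp: substitute_pattern_def S(1) split: pattern_letter.split)
  have "substitute_pattern S (map ?U [k..<k + Suc n]) =
    substitute_pattern S (map ?U [k..<k + n]) @ (if f ((k + n) * ?m) = hd S then S else exchange_first_two S)"
    by (simp add: substitute_pattern_def)
  moreover have "k * ?m + n * ?m = (k + n) * ?m" by (simp add: algebra_simps)
  ultimately show ?case using Suc block[of "k + n"] lenP by simp
qed

end

section \<open>The slope forced by the language\<close>

lemma cyclic_transition:
  assumes "\<And>j. P (j + g) = P (j::nat)" "P j1" "\<not> P j2" "g \<ge> 1"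
  shows "\<exists>j<g. P j \<and> \<not> P (j + 1)"
proof (rule ccontr)
  assume "\<not> ?thesis"
  then have step: "P j \<Longrightarrow> P (j + 1)" if "j < g" for j using that by auto
  have perk: "P (j + k * g) = P j" for j k
    by (induction k) (use assms(1) in \<open>auto simp: add.assoc[symmetric] add.commute[of g]\<close>)
  have step': "P j \<Longrightarrow> P (j + 1)" for j
  proof -
    assume "P j"
    then have "P (j mod g)" using perk[of "j mod g" "j div g"] by simp
    then have "P (j mod g + 1)" using step assms(4) by simp
    then show "P (j + 1)" using perk[of "j mod g + 1" "j div g"] by simp
  qed
  have "P (j1 + k)" for k by (induction k) (use assms(2) step' in auto)
  moreover have "j1 \<le> j2 + j1 * g" using assms(4) by (metis le_add2 le_trans mult.right_neutral mult_le_mono2)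
  then have "j1 + (j2 + j1 * g - j1) = j2 + j1 * g" by simp
  ultimately have "P (j2 + j1 * g)" by metis
  then show False using perk assms(3) by simp
qed

text \<open>The excluded boundary cases are the slopes of \<open>S5\<close> and \<open>S6\<close>: both have \<open>\<alpha> - a\<beta> = 1\<close>, with
  \<open>\<beta> = b + 1\<close> and \<open>\<beta> = b + 2\<close>.\<close>

lemma (in coprime_walk) lang_slope:
  assumes a: "a \<ge> 1" and \<alpha>\<beta>: "\<alpha> \<ge> int a * \<beta>" and m: "int m = \<alpha> + \<beta>" and g: "g \<ge> 1"
    and per: "\<And>p. f (p + g * m) = f p"
    and F: "block_sequence a b F" "\<And>i. i < 2 * (g * m) \<Longrightarrow> F (q + i) = f i"
    and nonconst: "f (j0 * m) = 0" "f (j1 * m) = 1"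
  shows "int (b + 1) * (\<alpha> - int a * \<beta>) < \<beta>" "\<beta> < int (b + 2) * (\<alpha> - int a * \<beta>)"
proof -
  define l where "l = \<alpha> - int a * \<beta>"
  have m0: "m > 0" using m pos by linarith
  have perP: "f ((j + g) * m) = f (j * m)" for j using per[of "j * m"] by (simp add: algebra_simps)
  \<comment> \<open>Some block beginning with 0 is cyclically followed by one beginning with 1, and
    conversely at \<open>i\<close>. A slope out of bounds violates the language at one of these
    junctions.\<close>
  obtain j where j: "j < g" "f (j * m) = 0" "f ((j + 1) * m) = 1"
    using cyclic_transition[of "\<lambda>j. f (j * m) = 0" g j0 j1] perP nonconst g by (auto simp: bit_not_zero_iff)
  obtain i where i: "i < g" "f (i * m) = 1" "f ((i + 1) * m) = 0"
    using cyclic_transition[of "\<lambda>j. f (j * m) = 1" g j1 j0] perP nonconst g by (auto simp: bit_not_one_iff)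
  have z: "H p = 0 \<longleftrightarrow> m dvd p" for p using height_zero_iff[of p] m by (metis int_dvd_int_iff)
  have le: "(k + 1) * m \<le> g * m" if "k < g" for k using that by (intro mult_le_mono1) simp
  have Fp: "F (q + i) = f i" if "i < 2 * (g * m)" for i using F(2)[OF that] .
  have gm: "g * m > 0" using g m0 by simp
  have next_zero: "j * m + d = (j + 1) * m" if "H (j * m + d) = 0" "0 < d" "d \<le> m" for j d
  proof -
    have "m dvd d" using that(1) z by (simp add: dvd_add_right_iff)
    then have "d = m" using that(2,3) by (simp add: dvd_imp_le le_antisym)
    then show ?thesis by simp
  qed
  have one_run: "F (q + p) = 1 \<longleftrightarrow> f p = 1" if "p \<le> g * m" for p using Fp[of p] that gm by simp
  have Hj: "H (j * m) = 0" "H (i * m) = 0" using z by auto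
  have fj1: "f (j * m + 1) = 1" and Hj1: "H (j * m + 1) = - \<beta>"
    using H_0[OF j(2)] Hj pos letter_neg[of "j * m + 1"] by auto
  \<comment> \<open>For \<open>l = 0\<close> the blocks are \<open>0 1 0^(a-1)\<close> and
    \<open>1 0^a\<close>; the first followed by the second has only \<open>a - 1\<close> zeros
    between two ones.\<close>
  have "l \<noteq> 0"
  proof
    assume "l = 0"
    then have "\<beta> dvd \<alpha>" by (simp add: l_def)
    then have "\<beta> = 1" using coprime pos by (simp add: coprime_absorb_right)
    then have ma: "m = a + 1" using m \<open>l = 0\<close> by (simp add: l_def)
    have "j * m + 1 \<le> g * m" using le[OF j(1)] m0 by simp
    then have "F (q + (j * m + 1)) = 1" using one_run fj1 by blast
    then have "F (q + (j * m + 1) + a) = 0" by (intro block_sequence_runs(1)[OF F(1)]) (use a in auto)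
    moreover have eq: "q + (j * m + 1) + a = q + (j + 1) * m" using ma by simp
    ultimately show False unfolding eq using j(3) one_run[OF le[OF j(1)]] by simp
  qed
  then interpret slope_walk f \<alpha> \<beta> a l
    using a \<alpha>\<beta> by unfold_locales (auto simp: l_def)
  have m_eq: "int m = int (a + 1) * \<beta> + l" using m by (simp add: l_def algebra_simps)
  \<comment> \<open>From height -\<beta> at \<open>j * m + 1\<close>, one of the next
    \<open>b + 2\<close> runs must be long. If \<open>(b + 2) l \<le> \<beta>\<close>, its extra
    zero can be read only at height 0, hence at \<open>(j + 1) * m\<close>, where the letter is
    1.\<close>
  show "\<beta> < int (b + 2) * (\<alpha> - int a * \<beta>)"
  proof (rule ccontr)
    assume "\<not> ?thesis"
    then have bl: "int (b + 2) * l \<le> \<beta>" by (simp add: l_def)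
    have small: "e * (a + 1) + 1 \<le> m" if "e \<le> b + 2" for e
    proof -
      have "int e * 1 \<le> int (b + 2) * l" using that l by (intro mult_mono) auto
      then have "int e * int (a + 1) \<le> \<beta> * int (a + 1)" using bl by (intro mult_right_mono) auto
      then have "int (e * (a + 1) + 1) \<le> int m" using m_eq l by (simp add: algebra_simps)
      then show ?thesis by linarith
    qed
    have idx: "j * m + 1 + e * (a + 1) \<le> g * m" if "e \<le> b + 2" for e
      using small[OF that] le[OF j(1)] by (simp add: algebra_simps)
    define p where "p = j * m + 1"
    have "p \<le> g * m" using idx[of 0] by (simp add: p_def)
    then have "F (q + p) = 1" using one_run fj1 p_def by blast
    then have ex: "\<exists>e. e \<ge> 1 \<and> e \<le> b + 2 \<and> F (q + p + e * (a + 1)) = 0"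
      using block_sequence_runs(3)[OF F(1)] by blast
    \<comment> \<open>Minimality makes all earlier runs short, so \<open>consecutive_runs\<close>
      yields the height.\<close>
    define e where "e = (LEAST e. e \<ge> 1 \<and> e \<le> b + 2 \<and> F (q + p + e * (a + 1)) = 0)"
    have e: "e \<ge> 1" "e \<le> b + 2" "F (q + p + e * (a + 1)) = 0"
      using LeastI_ex[OF ex] by (auto simp: e_def)
    have tr: "F (q + p + k * (a + 1)) = f (p + k * (a + 1))" if "k \<le> b + 2" for k
      using Fp[of "p + k * (a + 1)"] idx[OF that] gm by (simp add: p_def add.assoc)
    have "f (p + k * (a + 1)) = 1" if "k < e" for k
    proof (cases "k = 0")
      case True
      then show ?thesis using fj1 by (simp add: p_def)
    next
      case False
      then have "F (q + p + k * (a + 1)) \<noteq> 0"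
        using not_less_Least[of k "\<lambda>e. e \<ge> 1 \<and> e \<le> b + 2 \<and> F (q + p + e * (a + 1)) = 0"] that e(2)
        by (auto simp: e_def)
      then show ?thesis using tr[of k] that e(2) by (simp add: bit_not_zero_iff)
    qed
    then have Hp: "H (p + e * (a + 1)) = - \<beta> + int e * l"
      using consecutive_runs[of e p] Hj1 by (simp add: p_def)
    have f0: "f (p + e * (a + 1)) = 0" using tr[OF e(2)] e(3) by simp
    from zero[OF this] have "- \<beta> + int e * l \<ge> 0" using Hp by simp
    moreover have "int e * l \<le> int (b + 2) * l" using e(2) l by (intro mult_right_mono) auto
    ultimately have H0: "H (p + e * (a + 1)) = 0" using Hp bl by linarith
    have pe: "p + e * (a + 1) = j * m + (e * (a + 1) + 1)" by (simp add: p_def)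
    have "p + e * (a + 1) = (j + 1) * m"
      unfolding pe by (rule next_zero[OF H0[unfolded pe] _ small[OF e(2)]]) simp
    then show False using f0 j(3) by simp
  qed
  \<comment> \<open>The run at \<open>i * m\<close> is long and ends at height
    \<open>l - \<beta>\<close>; then the language prescribes a 1 at the starts of the next
    \<open>b + 1\<close> runs. If \<open>\<beta> \<le> (b + 1) l\<close>, one of these starts is the
    zero \<open>(i + 1) * m\<close>, where the letter is 0.\<close>
  show "int (b + 1) * (\<alpha> - int a * \<beta>) < \<beta>"
  proof (rule ccontr)
    assume "\<not> ?thesis"
    then have bl: "\<beta> \<le> int (b + 1) * l" by (simp add: l_def)
    \<comment> \<open>The number of short runs after which the height is first nonnegative:
      \<open>e l < \<beta> \<le> (e + 1) l\<close>.\<close>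
    define e where "e = nat ((\<beta> - 1) div l)"
    have e: "int e = (\<beta> - 1) div l" using pos l by (simp add: e_def pos_imp_zdiv_nonneg_iff)
    have e1: "int e * l \<le> \<beta> - 1" "\<beta> \<le> int e * l + l"
      unfolding e using l by (simp_all add: algebra_simps minus_mod_eq_mult_div[symmetric])
        (smt (verit) pos_mod_bound pos_mod_sign)+
    have "int e * l < int (b + 1) * l" using e1(1) bl by linarith
    then have eb: "e \<le> b" using l by simp
    have small: "k * (a + 1) + (a + 2) \<le> m" if "k \<le> e" for k
    proof -
      have "int e * 1 \<le> int e * l" using l by (intro mult_left_mono) auto
      then have "int k + 1 \<le> \<beta>" using e1(1) that by linarith
      then have "(int k + 1) * int (a + 1) \<le> \<beta> * int (a + 1)" by (intro mult_right_mono) auto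
      then have "int (k * (a + 1) + (a + 2)) \<le> int m" using m_eq l by (simp add: algebra_simps)
      then show ?thesis by linarith
    qed
    have idx: "i * m + (k * (a + 1) + (a + 2)) \<le> g * m" if "k \<le> e" for k
      using small[OF that] le[OF i(1)] by (simp add: algebra_simps)
    have H1: "H (i * m + (a + 1)) = l" using short_run(2)[OF i(2)] Hj by simp
    then have f1: "f (i * m + (a + 1)) = 0" using letter_pos l by simp
    have H2: "H (i * m + (a + 2)) = l - \<beta>" using H_0[OF f1] H1 by simp
    have "F (q + i * m) = 1" "F (q + i * m + (a + 1)) = 0"
      using Fp[of "i * m"] Fp[of "i * m + (a + 1)"] i(1,2) f1 m0 idx[of 0] by (simp_all add: add.assoc)
    note R = block_sequence_runs(2)[OF F(1) this]
    have ones: "f (i * m + (a + 2) + k * (a + 1)) = 1" if "k \<le> e" for k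
      using R[of k] that eb Fp[of "i * m + (a + 2) + k * (a + 1)"] idx[OF that] gm by (simp add: add_ac)
    have "H (i * m + (a + 2) + e * (a + 1)) = l - \<beta> + int e * l"
      using consecutive_runs[of e "i * m + (a + 2)"] ones H2 by simp
    moreover have "H (i * m + (a + 2) + e * (a + 1)) \<le> 0" using one ones by blast
    ultimately have "H (i * m + (e * (a + 1) + (a + 2))) = 0" using e1(2) by (simp add: add_ac)
    from next_zero[OF this _ small[OF order_refl]]
    have "i * m + (a + 2) + e * (a + 1) = (i + 1) * m" by (simp add: add_ac)
    then show False using ones[of e] i(3) by (metis order_refl zero_neq_one)
  qed
qed

section \<open>The classification\<close>

lemma substitute_pattern_simps [simp]:
  "substitute_pattern v [] = []"
  "substitute_pattern v (c # u) = (if c = Letter_S then v else exchange_first_two v) @ substitute_pattern v u"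
  "substitute_pattern v (u @ u') = substitute_pattern v u @ substitute_pattern v u'"
  by (auto simp: substitute_pattern_def split: pattern_letter.split)

lemma substitute_pattern_power: "substitute_pattern v (word_power u n) = word_power (substitute_pattern v u) n"
  by (induction n) auto

lemma length_exchange_first_two [simp]: "length (exchange_first_two v) = length v"
  by (cases v rule: exchange_first_two.cases) auto

lemma count_exchange_first_two [simp]: "count_list (exchange_first_two v) x = count_list v x"
  by (cases v rule: exchange_first_two.cases) auto

lemma length_substitute_pattern [simp]: "length (substitute_pattern v u) = length u * length v"
  by (induction u) auto

lemma count_substitute_pattern [simp]: "count_list (substitute_pattern v u) x = length u * count_list v x"
  by (induction u) auto

lemma primitive_nonempty: "primitive w \<Longrightarrow> w \<noteq> []"
  unfolding primitive_def by (metis word_power_simps(1) zero_neq_one)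

lemma primitive_coprime_counts:
  assumes "coprime (count_list w 0) (count_list w (1::bit))"
  shows "primitive w"
  unfolding primitive_def
proof (intro allI impI)
  fix v n assume "w = word_power v n"
  then have "n dvd count_list w 0" "n dvd count_list w 1" by auto
  then show "n = 1" using assms by (meson coprime_common_divisor nat_dvd_1_iff_1)
qed

lemma not_primitive_root:
  assumes "\<not> primitive w" "w \<noteq> []"
  shows "\<exists>v n. n \<ge> 1 \<and> primitive v \<and> w = word_power v n"
  using assms
proof (induction "length w" arbitrary: w rule: less_induct)
  case less
  then obtain v n where v: "w = word_power v n" "n \<noteq> 1" by (auto simp: primitive_def)
  then have n: "n \<ge> 2" "v \<noteq> []" using less.prems(2) by (cases n; auto simp: word_power_def)+
  show ?case
  proof (cases "primitive v")
    case True
    then show ?thesis using v n by (intro exI[of _ v] exI[of _ n]) auto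
  next
    case False
    have "length v < length w" using v n by simp
    then obtain u k where "k \<ge> 1" "primitive u" "v = word_power u k" using less.hyps False n by blast
    then show ?thesis using v n by (intro exI[of _ u] exI[of _ "k * n"]) (auto simp: word_power_mult)
  qed
qed

lemma periodic_word_power:
  assumes "n \<ge> 1" "v \<noteq> []"
  shows "periodic (word_power v n) = periodic v"
proof
  fix p
  have "word_power v n ! i = periodic v i" if "i < n * length v" for i n
    using that
  proof (induction n arbitrary: i)
    case (Suc n)
    show ?case
    proof (cases "i < length v")
      case False
      then have "word_power v (Suc n) ! i = periodic v (i - length v)"
        using Suc by (simp add: nth_append)
      then show ?thesis using False periodic_add[of v "i - length v"] by simp
    qed (simp add: nth_append periodic_def)
  qed simp
  then have "periodic (word_power v n) p = periodic v (p mod (n * length v))"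
    using assms by (simp add: periodic_def)
  also have "\<dots> = periodic v p" by (simp add: periodic_def mod_mod_cancel)
  finally show "periodic (word_power v n) p = periodic v p" .
qed

lemma power_from_period:
  assumes per: "\<And>p. periodic u (p + k) = periodic u p" and "length u = n * k" "k \<le> length u"
  shows "u = word_power (take k u) n"
proof -
  have perk: "periodic u (p + j * k) = periodic u p" for p j
    by (induction j) (use per in \<open>auto simp: add.assoc[symmetric] add.commute[of k]\<close>)
  have base: "occurs_at (periodic u) 0 (take k u)" by (rule occurs_at_take) simp
  have "occurs_at (periodic u) (j * k) (word_power (take k u) n)" for j n
  proof (induction n arbitrary: j)
    case (Suc n)
    have "occurs_at (periodic u) (j * k) (take k u)"
      using base perk[of _ j] by (auto simp: occurs_at_iff add.commute[of _ "j * k"])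
    then show ?case using Suc[of "Suc j"] assms(3) by (simp add: min_absorb2 add.commute)
  qed simp
  from this[of 0] show ?thesis
    using assms(2,3) by (intro occurs_at_unique[OF occurs_at_periodic0]) (auto simp: min_absorb2)
qed

lemma lang_take: "z \<in> lang a b \<Longrightarrow> take n z \<in> lang a b"
proof -
  assume "z \<in> lang a b"
  then obtain k m Xs where "z = stake k (sdrop m (flat Xs))" "sset Xs \<subseteq> {S5 a b, S6 a b}"
    by (auto simp: lang_def)
  moreover from this have "take n z = stake (min n k) (sdrop m (flat Xs))" by (simp add: take_stake)
  ultimately show ?thesis unfolding lang_def by blast
qed

lemma lang_factor_S6:
  assumes "S6 a b = p @ z @ s"
  shows "z \<in> lang a b"
proof -
  have "flat (sconst (S6 a b)) = S6 a b @- flat (sconst (S6 a b))"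
    using flat_unfold[of "sconst (S6 a b)"] by (simp add: S6_def)
  then have "flat (sconst (S6 a b)) = p @- z @- (s @- flat (sconst (S6 a b)))"
    by (simp add: assms)
  then obtain rest where rest: "flat (sconst (S6 a b)) = p @- z @- rest" by blast
  have "z = stake (length z) (sdrop (length p) (flat (sconst (S6 a b))))"
    unfolding rest by (simp add: sdrop_shift stake_shift)
  moreover have "sset (sconst (S6 a b)) \<subseteq> {S5 a b, S6 a b}" by simp
  ultimately show ?thesis unfolding lang_def by blast
qed

lemma solutionI:
  assumes "w \<noteq> []" "w @ w \<in> lang a b" "set Xs \<subseteq> min_square_roots a b" "w = concat Xs"
    "concat_squares Xs = w @ w"
  shows "solution a b w"
  using assms unfolding solution_def square_products_def by auto

lemma solution_root:
  assumes "X \<in> min_square_roots a b" "X \<noteq> []" "X @ X \<in> lang a b"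
  shows "solution a b X"
  using assms by (intro solutionI[of _ _ _ "[X]"]) auto

lemma primitive_solution_zero:
  assumes "a \<ge> 1"
  shows "primitive_solution a b [0]"
proof -
  have "S6 a b = [1] @ [0, 0] @ (replicate (a - 1) 0 @ word_power ([1] @ replicate a 0) (b + 1))"
    using assms by (cases a) (auto simp: S6_def)
  from lang_factor_S6[OF this] have "solution a b [0]"
    using solution_root[of "[0]" a b] by (simp add: min_square_roots_def S1_def)
  moreover have "primitive [0::bit]" by (rule primitive_coprime_counts) simp
  ultimately show ?thesis by (simp add: primitive_solution_def)
qed

section \<open>From walks to solutions\<close>

context params_walk
begin

text \<open>Iterates \<open>next_double_step\<close>. By \<open>no_interior_zero\<close> no factor
  jumps over the zero \<open>N\<close>, so the decomposition ends exactly there.\<close>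

lemma square_decomposition:
  assumes start: "\<And>t. H t = 0 \<Longrightarrow> f (2 * t) = f t" and N: "H N = 0"
    and t: "H (2 * t) = 2 * H t" "t \<le> N"
  shows "\<exists>Xs. set Xs \<subseteq> min_square_roots a b \<and> occurs_at f t (concat Xs) \<and>
    occurs_at f (2 * t) (concat_squares Xs) \<and> t + length (concat Xs) = N"
  using t
proof (induction "N - t" arbitrary: t rule: less_induct)
  case less
  show ?case
  proof (cases "t = N")
    case True
    then show ?thesis by (intro exI[of _ "[]"]) simp
  next
    case False
    obtain X where X: "X \<in> min_square_roots a b" "occurs_at f t X" "occurs_at f (2 * t) X"
      "occurs_at f (2 * t + length X) X"
      using next_double_step[OF less.prems(1) start] by blast
    then have step: "double_step a b f \<alpha> \<beta> t X" using less.prems by (simp add: double_step_def)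
    have "X \<noteq> []" using X(1) by (auto simp: min_square_roots_def S1_def S2_def S3_def S4_def S5_def S6_def)
    have "\<not> N < t + length X"
      using no_interior_zero[OF a _ step, of N] N False less.prems(2) \<alpha>_eq l by auto
    then have le: "t + length X \<le> N" by simp
    have "H (2 * (t + length X)) = H (2 * t + length X + length X)" by (simp add: algebra_simps)
    then have "H (2 * (t + length X)) = 2 * H (t + length X)"
      using prefix_height_occurs[OF X(2)] prefix_height_occurs[OF X(3)] prefix_height_occurs[OF X(4)]
        less.prems(1) by simp
    moreover have "N - (t + length X) < N - t" using \<open>X \<noteq> []\<close> le by (cases X) auto
    ultimately obtain Xs where "set Xs \<subseteq> min_square_roots a b" "occurs_at f (t + length X) (concat Xs)"
      "occurs_at f (2 * (t + length X)) (concat_squares Xs)" "t + length X + length (concat Xs) = N"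
      using less.hyps[OF _ _ le] by blast
    then show ?thesis using X
      by (intro exI[of _ "X # Xs"]) (auto simp: algebra_simps mult_2)
  qed
qed

end

lemma params_walk_solution:
  assumes "params_walk (periodic w) \<alpha> \<beta> a l b r" "w \<noteq> []" "height \<alpha> \<beta> w = 0"
    and start: "\<And>t. prefix_height (periodic w) \<alpha> \<beta> t = 0 \<Longrightarrow> periodic w (2 * t) = periodic w t"
  shows "solution a b w"
proof -
  interpret params_walk "periodic w" \<alpha> \<beta> a l b r by fact
  have "H (length w) = 0" using prefix_height_occurs[OF occurs_at_periodic0, of w \<alpha> \<beta>] assms(3) by simp
  from square_decomposition[OF start this, of 0] obtain Xs where Xs: "set Xs \<subseteq> min_square_roots a b"
    "occurs_at (periodic w) 0 (concat Xs)" "occurs_at (periodic w) 0 (concat_squares Xs)"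
    "length (concat Xs) = length w" by auto
  have "w = concat Xs" using occurs_at_unique[OF occurs_at_periodic0 Xs(2)] Xs(4) by simp
  moreover have "concat_squares Xs = w @ w"
    using occurs_at_unique[OF Xs(3) occurs_at_periodic_square] Xs(4) by (simp add: length_concat_squares)
  moreover have "w @ w \<in> lang a b"
    by (rule lang_occurs[of "length w", OF _ _ occurs_at_periodic_square]) (use assms(2) in auto)
  ultimately show ?thesis using solutionI[OF assms(2)] Xs(1) by blast
qed

section \<open>Pattern words and the implications of the theorem\<close>

lemma word_without_one: "1 \<notin> set (w::word) \<Longrightarrow> w = word_power [0] (length w)"
  by (induction w) (auto simp: bit_not_one_iff)

lemma periodic_mod [simp]: "periodic w (p mod length w) = periodic w p"
  by (simp add: periodic_def)

lemma periodic_double_mod: "periodic w (2 * (p mod length w)) = periodic w (2 * p)"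
  by (simp add: periodic_def mod_mult_right_eq)

text \<open>The orbit condition is generated by the relation between \<open>j\<close> and
  \<open>2 * j\<close> alone.\<close>

lemma pattern_word_from_doubling:
  assumes "u \<noteq> []" and double: "\<And>j. periodic u (2 * j) = periodic u j"
  shows "pattern_word u"
  unfolding pattern_word_def
proof (intro conjI allI impI)
  fix i j assume ij: "i < length u" "j < length u" "\<exists>k1 k2. [2 ^ k1 * i = 2 ^ k2 * j] (mod length u)"
  have pow: "periodic u (2 ^ k * i) = periodic u i" for k i
    by (induction k) (use double in \<open>auto simp: mult.assoc\<close>)
  obtain k1 k2 where "[2 ^ k1 * i = 2 ^ k2 * j] (mod length u)" using ij(3) by blast
  then have "periodic u (2 ^ k1 * i) = periodic u (2 ^ k2 * j)" by (simp add: periodic_def cong_def)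
  then show "u ! i = u ! j" using pow ij by (simp add: periodic_def)
qed fact

lemma pattern_word_doubling:
  assumes "pattern_word u"
  shows "periodic u (2 * j) = periodic u j"
proof -
  have n: "length u > 0" using assms by (auto simp: pattern_word_def)
  have "[2 ^ 1 * (j mod length u) = 2 ^ 0 * (2 * j mod length u)] (mod length u)"
    by (simp add: cong_def mod_mult_right_eq)
  then have "u ! (j mod length u) = u ! (2 * j mod length u)"
    using assms n unfolding pattern_word_def by (meson mod_less_divisor)
  then show ?thesis by (simp add: periodic_def)
qed

text \<open>For \<open>g = 1\<close> the word is a single block, the reversed standard word with its
  first letter. For \<open>g > 1\<close> primitivity makes the pattern nonconstant, and
  \<open>lang_slope\<close> supplies the parameters of the block.\<close>

lemma primitive_solution_classification:
  assumes a: "a \<ge> 1" and sol: "primitive_solution a b w"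
  shows "reversed_standard_word w \<or> pattern_type a b w"
proof (cases "1 \<in> set w")
  case False
  have prim: "primitive w" using sol by (simp add: primitive_solution_def)
  have w0: "w = word_power [0] (length w)" using word_without_one[OF False] .
  then have "length w = 1" using prim unfolding primitive_def by blast
  then have "w = [0]" using w0 by simp
  then have "standard_word (rev w)"
    unfolding standard_word_def by (intro disjI2 exI[of _ "\<lambda>_. 1"] exI[of _ 0]) simp
  then show ?thesis by (simp add: reversed_standard_word_def)
next
  case True
  have prim: "primitive w" and sol': "solution a b w" using sol by (auto simp: primitive_solution_def)
  obtain \<alpha> \<beta> g :: nat where cop: "coprime \<alpha> \<beta>" and \<beta>: "\<beta> \<ge> 1" and \<alpha>\<beta>: "\<alpha> \<ge> a * \<beta>"
    and g: "g \<ge> 1" and cnt: "count_list w 0 = g * \<alpha>" "count_list w 1 = g * \<beta>"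
    and walk: "walk (periodic w) (int \<alpha>) (int \<beta>)"
    and dbl: "\<And>p. p < length w \<Longrightarrow> prefix_height (periodic w) (int \<alpha>) (int \<beta>) p = 0 \<Longrightarrow>
      periodic w (2 * p) = periodic w p"
    by (rule solution_walk[OF a sol' True]) blast
  let ?f = "periodic w"
  interpret coprime_walk ?f "int \<alpha>" "int \<beta>"
    using walk cop by (simp add: coprime_walk_def coprime_walk_axioms_def)
  define m where "m = \<alpha> + \<beta>"
  have len: "length w = g * m" using length_bit_word[of w] cnt by (simp add: m_def algebra_simps)
  have ne: "w \<noteq> []" using True by auto
  have z: "H p = 0 \<longleftrightarrow> m dvd p" for p using height_zero_iff[of p] by (simp add: m_def flip: of_nat_add)
  have "1 * \<beta> \<le> a * \<beta>" using a by (rule mult_le_mono1)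
  then have \<beta>\<alpha>: "\<beta> \<le> \<alpha>" using \<alpha>\<beta> by linarith
  note ex = exists_reversed_standard[OF cop \<beta> \<beta>\<alpha>]
  show ?thesis
  proof (cases "g = 1")
    case True
    obtain v where v: "reversed_standard_word v" "count_list v 0 = \<alpha>" "count_list v 1 = \<beta>"
      "hd v = hd w" "walk_word (int \<alpha>) (int \<beta>) 0 v" using ex by blast
    have "occurs_at ?f 0 v"
      using occurs_walk_word[OF v(5), of 0] v ne by (simp add: periodic_def hd_conv_nth)
    moreover have "length v = length w" using length_bit_word[of v] v len True by (simp add: m_def)
    ultimately have "w = v" using occurs_at_unique[OF occurs_at_periodic0] by metis
    then show ?thesis using v by simp
  next
    case False
    then have g2: "g > 1" using g by simp
    \<comment> \<open>Fixing the first letter only decides which of the two blocks is called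
      \<open>Letter_S\<close>.\<close>
    obtain S where S: "count_list S 0 = \<alpha>" "count_list S 1 = \<beta>" "hd S = 1" "walk_word (int \<alpha>) (int \<beta>) 0 S"
      and Sab: "\<And>a b l r. \<alpha> = a * \<beta> + l \<and> \<beta> = (b + 1) * l + r \<and> 0 < r \<and> r < l \<Longrightarrow> reversed_standard_word_with a b S"
      using ex[of 1] by blast
    have lenS: "length S = m" using length_bit_word[of S] S by (simp add: m_def)
    define U where "U = (\<lambda>j. if ?f (j * m) = hd S then Letter_S else Letter_L)"
    define u where "u = map U [0..<g]"
    have u_len: "length u = g" by (simp add: u_def)
    have occ: "occurs_at ?f 0 (substitute_pattern S u)"
      using occurs_substitute_pattern[OF S(4), of 0 g] S(1,2) unfolding u_def U_def lenS by simp
    have w: "w = substitute_pattern S u"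
      by (rule occurs_at_unique[OF occurs_at_periodic0 occ]) (simp add: u_len lenS len)
    have prim_u: "primitive u"
      unfolding primitive_def
    proof (intro allI impI)
      fix v n assume "u = word_power v n"
      then have "w = word_power (substitute_pattern S v) n" using w substitute_pattern_power by simp
      then show "n = 1" using prim unfolding primitive_def by blast
    qed
    have Uper: "periodic u j = U j" for j
    proof -
      have "j mod g < g" using g by simp
      then have "periodic u j = U (j mod g)" by (simp add: periodic_def u_def)
      moreover have "(j mod g) * m = (j * m) mod length w" by (simp add: len mod_mult_mult2)
      ultimately show ?thesis unfolding U_def by simp
    qed
    have "?f (2 * (j * m)) = ?f (j * m)" for j
    proof -
      have "H ((j * m) mod length w) = 0" unfolding z len by (simp add: dvd_mod)
      then have "?f (2 * ((j * m) mod length w)) = ?f ((j * m) mod length w)"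
        using ne by (intro dbl) auto
      then show ?thesis by (simp add: periodic_double_mod)
    qed
    then have "U (2 * j) = U j" for j by (simp add: U_def mult.assoc)
    then have pat: "pattern_word u"
      by (intro pattern_word_from_doubling) (use Uper u_len g in auto)
    have nonconst: "(\<exists>j. ?f (j * m) = 0) \<and> (\<exists>j. ?f (j * m) = 1)"
    proof (rule ccontr)
      assume "\<not> ?thesis"
      then have "\<exists>c. U = (\<lambda>_. c)" unfolding U_def S(3) by (auto simp: bit_not_zero_iff)
      then obtain c where "U = (\<lambda>_. c)" by blast
      then have "u = replicate g c" unfolding u_def by (simp add: map_replicate_const)
      then have "u = word_power [c] g" by simp
      then have "g = 1" using prim_u unfolding primitive_def by blast
      then show False using g2 by simp
    qed
    have "w @ w \<in> lang a b" using sol' by (simp add: solution_def square_products_def)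
    then obtain F q where F: "block_sequence a b F" "\<And>i. i < length (w @ w) \<Longrightarrow> F (q + i) = (w @ w) ! i"
      using lang_block_sequence by blast
    have Ff: "F (q + i) = ?f i" if "i < 2 * (g * m)" for i
      using F(2)[of i] that occurs_at_periodic_square[of w] len by (simp add: occurs_at_iff)
    obtain j0 j1 where j: "?f (j0 * m) = 0" "?f (j1 * m) = 1" using nonconst by blast
    have per: "?f (p + g * m) = ?f p" for p by (simp flip: len)
    have "int a * int \<beta> \<le> int \<alpha>" "int m = int \<alpha> + int \<beta>" using \<alpha>\<beta> by (simp_all add: m_def flip: of_nat_mult)
    note slope = lang_slope[OF a this g per F(1) Ff j]
    define l where "l = \<alpha> - a * \<beta>"
    have \<alpha>l: "\<alpha> = a * \<beta> + l" using \<alpha>\<beta> by (simp add: l_def)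
    have il: "int \<alpha> - int a * int \<beta> = int l" using \<alpha>l by simp
    have bl: "(b + 1) * l < \<beta>" "\<beta> < (b + 2) * l"
      using slope unfolding il by (simp_all only: of_nat_less_iff flip: of_nat_mult)
    define r where "r = \<beta> - (b + 1) * l"
    have r: "\<beta> = (b + 1) * l + r" "0 < r" "r < l" using bl by (simp_all add: r_def)
    have "length S > length (S6 a b)"
    proof -
      have "l \<ge> 2" using r by simp
      then have "(b + 1) * 2 \<le> (b + 1) * l" by (rule mult_le_mono2)
      then have "\<beta> \<ge> b + 2" using r by simp
      then have "(a + 1) * (b + 2) \<le> (a + 1) * \<beta>" by (rule mult_le_mono2)
      moreover have "m = (a + 1) * \<beta> + l" using \<alpha>l by (simp add: m_def)
      moreover have "length (S6 a b) = (a + 1) * (b + 2) + 1" by (simp add: S6_def algebra_simps)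
      ultimately show ?thesis using \<open>l \<ge> 2\<close> lenS by linarith
    qed
    then have "pattern_type a b w"
      unfolding pattern_type_def using Sab[of a l b r] \<alpha>l r pat prim_u w u_len g2 by blast
    then show ?thesis ..
  qed
qed

text \<open>The remainder \<open>r\<close> is positive, so \<open>params_walk\<close> holds with
  both kinds of blocks present. The letters at the zeros \<open>t\<close> and \<open>2 * t\<close>
  agree by the pattern condition.\<close>

lemma pattern_type_solution:
  assumes a: "a \<ge> 1" and "pattern_type a b w"
  shows "primitive_solution a b w"
proof -
  obtain S u where S: "reversed_standard_word_with a b S" "length S > length (S6 a b)"
    and u: "pattern_word u" "length u > 1" "primitive u" and w: "w = substitute_pattern S u"
    using assms(2) unfolding pattern_type_def by blast
  define \<alpha> where "\<alpha> = count_list S 0"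
  define \<beta> where "\<beta> = count_list S 1"
  define g where "g = length u"
  define m where "m = length S"
  obtain l r where lr: "\<alpha> = a * \<beta> + l" "\<beta> = (b + 1) * l + r" "0 < r" "r < l"
    using reversed_standard_word_with_counts[OF S] unfolding \<alpha>_def \<beta>_def by blast
  have cop: "coprime \<alpha> \<beta>" and walkS: "walk_word (int \<alpha>) (int \<beta>) 0 S"
    using S(1) reversed_standard_walk unfolding reversed_standard_word_with_def \<alpha>_def \<beta>_def by blast+
  have "\<alpha> > 0" "\<beta> > 0" using lr by linarith+
  then have pos: "int \<alpha> > 0" "int \<beta> > 0" by simp_all
  have mS: "m = \<alpha> + \<beta>" unfolding m_def \<alpha>_def \<beta>_def by (rule length_bit_word)
  then have "length S \<ge> 2" using pos by (simp add: m_def)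
  from exchange_first_two_walk[OF walkS pos this]
  obtain x y rest where xy: "S = x # y # rest" "x \<noteq> y" "exchange_first_two S = y # x # rest"
    "walk_word (int \<alpha>) (int \<beta>) 0 (y # x # rest)" by metis
  have hS: "height (int \<alpha>) (int \<beta>) S = 0" "height (int \<alpha>) (int \<beta>) (exchange_first_two S) = 0"
    unfolding height_def by (simp_all add: \<alpha>_def \<beta>_def)
  have hP: "height (int \<alpha>) (int \<beta>) (substitute_pattern S v) = 0" for v
    by (induction v) (simp_all add: hS)
  have walk_w: "walk_word (int \<alpha>) (int \<beta>) 0 (substitute_pattern S v)" for v
    using walkS xy(4) hS by (induction v) (simp_all add: xy(3)[symmetric])
  have len: "length w = g * m" by (simp add: w g_def m_def)
  then have ne: "w \<noteq> []" using u(2) mS pos by (auto simp: g_def)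
  let ?f = "periodic w"
  interpret coprime_walk ?f "int \<alpha>" "int \<beta>"
    using walk_periodic[OF walk_w[of u, folded w] hP[of u, folded w] ne pos] cop
    by (simp add: coprime_walk_def coprime_walk_axioms_def)
  have z: "H p = 0 \<longleftrightarrow> m dvd p" for p using height_zero_iff[of p] by (simp add: mS flip: of_nat_add)
  have sub: "substitute_pattern S v ! (j * m) = (if v ! j = Letter_S then x else y)" if "j < length v" for v j
    using that
  proof (induction v arbitrary: j)
    case (Cons c v)
    show ?case
    proof (cases j)
      case 0
      then show ?thesis by (simp add: xy nth_append)
    next
      case (Suc i)
      then show ?thesis using Cons by (auto simp: nth_append m_def)
    qed
  qed simp
  have letter: "?f (j * m) = (if periodic u j = Letter_S then x else y)" for j
  proof -
    have "(j * m) mod length w = (j mod g) * m" by (simp add: len mod_mult_mult2)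
    moreover have "length u > 0" using u(2) by linarith
    then have "j mod g < length u" unfolding g_def by (rule mod_less_divisor)
    ultimately show ?thesis using sub[of "j mod g" u] by (simp add: periodic_def w g_def)
  qed
  have params: "params_walk ?f (int \<alpha>) (int \<beta>) a (int l) b (int r)"
    by unfold_locales (use lr a in \<open>auto simp: algebra_simps\<close>)
  have "?f (2 * t) = ?f t" if "H t = 0" for t
  proof -
    from that have "m dvd t" using z by blast
    then obtain j where "t = m * j" ..
    then have "t = j * m" by simp
    then show ?thesis using letter[of j] letter[of "2 * j"] pattern_word_doubling[OF u(1), of j]
      by (simp add: mult.assoc)
  qed
  from params_walk_solution[OF params ne hP[of u, folded w] this] have "solution a b w" .
  moreover have "primitive w"
    unfolding primitive_def
  proof (intro allI impI)
    fix v n assume v: "w = word_power v n"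
    have n: "n \<ge> 1" "v \<noteq> []"
      using ne unfolding v word_power_def by (auto simp: Suc_le_eq)
    \<comment> \<open>The exponent divides both counts, hence their gcd \<open>g\<close>. So the
      root is as long as \<open>k\<close> blocks, and its period passes from \<open>w\<close> to
      \<open>u\<close>.\<close>
    have "n dvd g * \<alpha>" "n dvd g * \<beta>"
      using arg_cong[OF v, of "\<lambda>w. count_list w 0"] arg_cong[OF v, of "\<lambda>w. count_list w 1"]
      by (simp_all add: w g_def \<alpha>_def \<beta>_def)
    then have "n dvd gcd (g * \<alpha>) (g * \<beta>)" by simp
    also have "gcd (g * \<alpha>) (g * \<beta>) = g" using cop by (simp add: gcd_mult_distrib_nat[symmetric])
    finally obtain k where k: "g = n * k" ..
    have "n * length v = n * (k * m)" using arg_cong[OF v, of length] len k by (auto simp: mult.assoc)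
    then have "length v = k * m" using n by simp
    then have fper: "?f (p + k * m) = ?f p" for p
      using periodic_word_power[OF n] v periodic_add[of v p] by simp
    have "periodic u (j + k) = periodic u j" for j
    proof -
      have "?f ((j + k) * m) = ?f (j * m)" using fper[of "j * m"] by (simp add: algebra_simps)
      then have "(periodic u (j + k) = Letter_S) = (periodic u j = Letter_S)"
        using letter[of j] letter[of "j + k"] xy(2) by (auto split: if_splits)
      then show ?thesis by (metis pattern_letter.exhaust)
    qed
    then have "u = word_power (take k u) n"
      using k n(1) by (intro power_from_period) (auto simp: g_def)
    then show "n = 1" using u(3) unfolding primitive_def by blast
  qed
  ultimately show ?thesis by (simp add: primitive_solution_def)
qed

text \<open>The primitive root \<open>v\<close> has height 0 too, so its end is a zero, where
  \<open>solution_walk\<close> cuts the decomposition of \<open>w\<close>. A word without 1 is a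
  power of \<open>0\<close>.\<close>

lemma nonprimitive_solution:
  assumes a: "a \<ge> 1" and sol: "solution a b w" and "\<not> primitive w"
  shows "\<exists>v n. primitive_solution a b v \<and> w = word_power v n"
proof (cases "1 \<in> set w")
  case False
  show ?thesis
    by (intro exI[of _ "[0]"] exI[of _ "length w"] conjI primitive_solution_zero[OF a] word_without_one[OF False])
next
  case True
  then have ne: "w \<noteq> []" by auto
  obtain v n where v: "n \<ge> 1" "primitive v" "w = word_power v n"
    using not_primitive_root[OF assms(3) ne] by blast
  have vne: "v \<noteq> []" using primitive_nonempty[OF v(2)] .
  have "n \<noteq> 1" using assms(3) v(2,3) by auto
  then have "2 \<le> n" using v(1) by simp
  then obtain k where "n = 2 + k" using le_Suc_ex by blast
  then have k: "n = Suc (Suc k)" by simp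
  obtain \<alpha> \<beta> g :: nat where cnt: "count_list w 0 = g * \<alpha>" "count_list w 1 = g * \<beta>"
    and dp: "\<And>p. p < length w \<Longrightarrow> prefix_height (periodic w) (int \<alpha>) (int \<beta>) p = 0 \<Longrightarrow>
      \<exists>Ys. set Ys \<subseteq> min_square_roots a b \<and> occurs_at (periodic w) 0 (concat Ys) \<and>
        occurs_at (periodic w) 0 (concat_squares Ys) \<and> length (concat Ys) = p"
    by (rule solution_walk[OF a sol True]) blast
  have fv: "periodic w = periodic v" using periodic_word_power[OF v(1) vne] v(3) by simp
  have "height (int \<alpha>) (int \<beta>) w = 0" unfolding height_def cnt by simp
  then have "height (int \<alpha>) (int \<beta>) v = 0" using v(1,3) by simp
  then have "prefix_height (periodic w) (int \<alpha>) (int \<beta>) (length v) = 0"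
    using prefix_height_occurs[OF occurs_at_periodic0, of v] fv by simp
  moreover have "length v < length w" using vne by (simp add: v(3) k)
  ultimately obtain Ys where Ys: "set Ys \<subseteq> min_square_roots a b" "occurs_at (periodic v) 0 (concat Ys)"
    "occurs_at (periodic v) 0 (concat_squares Ys)" "length (concat Ys) = length v"
    using dp[of "length v"] unfolding fv by blast
  have 1: "v = concat Ys" using occurs_at_unique[OF occurs_at_periodic0 Ys(2)] Ys(4) by simp
  have 2: "concat_squares Ys = v @ v"
    using occurs_at_unique[OF Ys(3) occurs_at_periodic_square] Ys(4) by (simp add: length_concat_squares)
  have vv: "v @ v = take (2 * length v) (w @ w)" by (simp add: v(3) k)
  have "w @ w \<in> lang a b" using sol by (simp add: solution_def square_products_def)
  then have "v @ v \<in> lang a b" unfolding vv by (rule lang_take)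
  then have "solution a b v" using solutionI[OF vne] Ys(1) 1 2 by blast
  then show ?thesis using v by (auto simp: primitive_solution_def)
qed

text \<open>The parameters are Euclidean quotients. For \<beta> \<le> 1 there are too few of them,
  but \<open>w\<close> is then a minimal root itself. For \<beta> \<ge> 2 the zeros are the
  multiples of \<open>length w\<close> and all carry the first letter, so \<open>r = 0\<close> is
  allowed.\<close>

lemma walk_word_solution:
  fixes \<alpha> \<beta> :: nat
  assumes cop: "coprime \<alpha> \<beta>" and cnt: "count_list w 0 = \<alpha>" "count_list w 1 = \<beta>"
    and walk_w: "walk_word (int \<alpha>) (int \<beta>) 0 w" and "\<beta> \<le> \<alpha>"
  shows "\<exists>a b. a \<ge> 1 \<and> primitive_solution a b w"
proof -
  have prim: "primitive w" using primitive_coprime_counts cop cnt by simp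
  have len: "length w = \<alpha> + \<beta>" using length_bit_word[of w] cnt by simp
  consider "\<beta> = 0" | "\<beta> = 1" | "\<beta> \<ge> 2" by linarith
  then show ?thesis
  proof cases
    case 1
    then have "\<alpha> = 1" using cop by simp
    then have "w = [0]" using len cnt 1
      by (cases w) (auto split: if_splits simp: bit_not_one_iff)
    then show ?thesis using primitive_solution_zero[of 1 0] by auto
  next
    case 2
    then have \<alpha>: "\<alpha> \<ge> 1" using assms(5) by simp
    have zeros: "v = replicate (length v) 0" if "count_list v (1::bit) = 0" for v
      using that word_without_one[of v] by (simp add: count_list_0_iff)
    have "w \<noteq> []" using 2 cnt by auto
    then obtain x v where w: "w = x # v" by (cases w) auto
    \<comment> \<open>\<open>b = 1\<close> gives \<open>S6\<close> two short runs, enough to contain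
      the square of \<open>w\<close>.\<close>
    have "solution \<alpha> 1 w"
    proof (cases "x = 1")
      case True
      then have "v = replicate \<alpha> 0" using zeros[of v] cnt w len 2 by simp
      then have wS: "w = S4 \<alpha>" using True w by (simp add: S4_def)
      have "S6 \<alpha> 1 = ([1] @ replicate (\<alpha> + 1) 0) @ (w @ w) @ []" by (simp add: S6_def wS S4_def)
      from lang_factor_S6[OF this] show ?thesis
        by (intro solution_root) (auto simp: wS min_square_roots_def S4_def)
    next
      case False
      then have x: "x = 0" by (simp add: bit_not_one_iff)
      obtain y s where v: "v = y # s" using len 2 \<alpha> w by (cases v) auto
      have y: "y = 1" using walk_w 2 bit_disj[of y] by (auto simp: w v x)
      then have s: "s = replicate (length s) 0" using zeros[of s] cnt w v x 2 by simp
      have "length s = \<alpha> - 1" using w v len 2 by simp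
      then have "s = replicate (\<alpha> - 1) 0" using s by simp
      then have wS: "w = S2 \<alpha>" using w v x y by (simp add: S2_def)
      have "replicate \<alpha> (0::bit) = replicate (\<alpha> - 1) 0 @ [0]"
        using \<alpha> by (cases \<alpha>) (auto simp: replicate_append_same)
      then have "S6 \<alpha> 1 = ([1] @ replicate \<alpha> 0) @ (w @ w) @ [0]"
        by (simp add: S6_def wS S2_def replicate_append_same[symmetric] del: replicate_Suc)
          (simp add: replicate_app_Cons_same)
      from lang_factor_S6[OF this] show ?thesis
        by (intro solution_root) (auto simp: wS min_square_roots_def S2_def)
    qed
    then show ?thesis using \<alpha> prim by (auto simp: primitive_solution_def)
  next
    case 3
    define a where "a = \<alpha> div \<beta>"
    define l where "l = \<alpha> mod \<beta>"
    \<comment> \<open>No truncation: \<open>l < \<beta>\<close> makes the quotient positive.\<close>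
    define b where "b = \<beta> div l - 1"
    define r where "r = \<beta> mod l"
    have a: "a \<ge> 1" using assms(5) 3 by (simp add: a_def div_greater_zero_iff Suc_le_eq)
    have \<alpha>l: "\<alpha> = a * \<beta> + l" by (simp add: a_def l_def)
    have "l \<noteq> 0"
    proof
      assume "l = 0"
      then have "\<beta> dvd \<alpha>" by (simp add: l_def mod_eq_0_iff_dvd)
      then show False using cop 3 by (simp add: coprime_absorb_right)
    qed
    then have l: "l \<ge> 1" "l < \<beta>" using 3 by (auto simp: l_def)
    then have "\<beta> div l \<ge> 1" by (simp add: div_greater_zero_iff Suc_le_eq)
    then have \<beta>r: "\<beta> = (b + 1) * l + r" by (simp add: b_def r_def)
    have r: "r < l" using l by (simp add: r_def)
    have ne: "w \<noteq> []" using len 3 by auto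
    have h: "height (int \<alpha>) (int \<beta>) w = 0" by (simp add: height_def cnt)
    have pos: "int \<alpha> > 0" "int \<beta> > 0" using 3 assms(5) by auto
    interpret coprime_walk "periodic w" "int \<alpha>" "int \<beta>"
      using walk_periodic[OF walk_w h ne pos] cop by (simp add: coprime_walk_def coprime_walk_axioms_def)
    have zero_letter: "periodic w p = w ! 0 \<and> periodic w (2 * p) = w ! 0" if "H p = 0" for p
    proof -
      have "length w dvd p" using that height_zero_iff[of p] by (simp add: len flip: of_nat_add)
      then show ?thesis by (simp add: periodic_def)
    qed
    have "params_walk (periodic w) (int \<alpha>) (int \<beta>) a (int l) b (int r)"
      by unfold_locales (use \<alpha>l \<beta>r r l a zero_letter in \<open>auto simp: algebra_simps\<close>)
    from params_walk_solution[OF this ne h] have "solution a b w" using zero_letter by metis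
    then show ?thesis using a prim by (auto simp: primitive_solution_def)
  qed
qed

lemma exchange_letters_counts:
  "count_list (exchange_letters w) 0 = count_list w 1" "count_list (exchange_letters w) 1 = count_list w 0"
  by (induction w) (auto simp: exchange_letters_def bit_not_zero_iff bit_not_one_iff)

lemma walk_word_exchange_letters:
  "walk_word \<alpha> \<beta> h w \<Longrightarrow> walk_word \<beta> \<alpha> (- h) (exchange_letters w)"
proof (induction w arbitrary: h)
  case (Cons x w)
  show ?case
  proof (cases "x = 1")
    case True
    then have "walk_word \<beta> \<alpha> (- (h + \<alpha>)) (exchange_letters w)" "h \<le> 0"
      using Cons.IH[of "h + \<alpha>"] Cons.prems by simp_all
    then show ?thesis using True by (simp add: exchange_letters_def)
  next
    case False
    then have "walk_word \<beta> \<alpha> (- (h - \<beta>)) (exchange_letters w)" "h \<ge> 0"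
      using Cons.IH[of "h - \<beta>"] Cons.prems by simp_all
    then show ?thesis using False by (simp add: exchange_letters_def bit_not_one_iff)
  qed
qed (simp add: exchange_letters_def)

text \<open>\<open>walk_word_solution\<close> asks for at least as many zeros as ones; the exchange,
  which negates heights, covers the other words, including \<open>1\<close>.\<close>

lemma reversed_standard_solution:
  assumes "reversed_standard_word w"
  shows "\<exists>a b. a \<ge> 1 \<and> (primitive_solution a b w \<or> primitive_solution a b (exchange_letters w))"
proof -
  let ?\<alpha> = "count_list w 0" and ?\<beta> = "count_list w 1"
  have *: "coprime ?\<alpha> ?\<beta> \<and> walk_word (int ?\<alpha>) (int ?\<beta>) 0 w"
  proof (cases "w = [1]")
    case True
    then show ?thesis by simp
  next
    case False
    then have "rev w \<noteq> [1]" by (metis rev_rev_ident rev_singleton_conv)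
    then obtain d k where "\<forall>i\<ge>1. d i \<ge> 1" "rev w = standard_seq d k"
      using assms unfolding reversed_standard_word_def standard_word_def by blast
    then show ?thesis using reversed_standard_walk[of d w k] by (metis rev_rev_ident)
  qed
  show ?thesis
  proof (cases "?\<beta> \<le> ?\<alpha>")
    case True
    then show ?thesis using walk_word_solution[of ?\<alpha> ?\<beta> w] * by auto
  next
    case False
    then show ?thesis
      using walk_word_solution[of ?\<beta> ?\<alpha> "exchange_letters w"] * walk_word_exchange_letters[of _ _ 0 w]
      by (auto simp: exchange_letters_counts coprime_commute)
  qed
qed

theorem theorem3p1:
  fixes a b :: nat
  assumes "a \<ge> 1"
  shows "(\<forall>w. primitive_solution a b w \<longrightarrow> reversed_standard_word w \<or> pattern_type a b w) \<and>
    (\<forall>w. reversed_standard_word w \<longrightarrow>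
       (\<exists>a' b'. a' \<ge> 1 \<and>
          (primitive_solution a' b' w \<or> primitive_solution a' b' (exchange_letters w)))) \<and>
    (\<forall>w. pattern_type a b w \<longrightarrow> primitive_solution a b w) \<and>
    (\<forall>w. solution a b w \<and> \<not> primitive w \<longrightarrow>
       (\<exists>v n. primitive_solution a b v \<and> w = word_power v n))"
  using primitive_solution_classification[OF assms] reversed_standard_solution
    pattern_type_solution[OF assms] nonprimitive_solution[OF assms] by blast

end
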